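(* Let $(\mathcal{C},\mathcal{W})$ be a relative category. Assume that for a small category $I$ there exists the colimit $\mathrm{colim}_I:\mathcal{C}^I\to\mathcal{C}$. If $\mathrm{hocolim}_I:(\mathcal{C}^I,\mathcal{W})\to(\mathcal{C},\mathcal{W})$ is a realizable homotopy colimit on $(\mathcal{C},\mathcal{W})$, then the absolute left derived functor $\mathbb{L}\mathrm{colim}_I$ of $\mathrm{colim}_I$ exists and it agrees with the functor $\mathrm{hocolim}_I:\mathcal{C}^I[\mathcal{W}^{-1}]\to\mathcal{C}[\mathcal{W}^{-1}]$ induced by the realizable homotopy colimit on localizations.
   Context: A relative category $(\mathcal{C},\mathcal{W})$ is a category $\mathcal{C}$ with a class $\mathcal{W}$ of morphisms (weak equivalences) which is saturated: $\mathcal{W}$ is exactly the class of morphisms sent to isomorphisms by the localization functor $\gamma:\mathcal{C}\to\mathcal{C}[\mathcal{W}^{-1}]$. For a category $I$, $\mathcal{C}^I$ is the functor category with the pointwise weak equivalences, again denoted $\mathcal{W}$. A relative functor is a functor preserving weak equivalences. $Fun(\mathcal{C},\mathcal{D})[\mathcal{W}^{-1}]$ denotes the category of relative functors from $\mathcal{C}$ to $\mathcal{D}$ localized by the pointwise weak equivalences; a relative natural transformation $F\dashrightarrow G$ is a morphism of this category. With these 1- and 2-morphisms (and the evident compositions) relative categories form a 2-category $\mathcal{R}el\mathcal{C}at$. A relative adjunction is an adjunction in $\mathcal{R}el\mathcal{C}at$: relative functors $F:\mathcal{C}\to\mathcal{D}$, $G:\mathcal{D}\to\mathcal{C}$ with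 relative natural transformations $\alpha:FG\dashrightarrow 1_{\mathcal{D}}$, $\beta:1_{\mathcal{C}}\dashrightarrow GF$ satisfying the triangle identities in the localized functor categories. A realizable homotopy colimit (for a small category $I$) is a relative adjunction $(\mathrm{hocolim}_I,c_I,\alpha,\beta)$ between $(\mathcal{C}^I,\mathcal{W})$ and $(\mathcal{C},\mathcal{W})$, where $c_I:\mathcal{C}\to\mathcal{C}^I$ is the constant diagram functor; $\mathrm{hocolim}_I$ itself is also called a realizable homotopy colimit. The absolute left derived functor of $F:\mathcal{C}\to\mathcal{D}$ between relative categories is the absolute right Kan extension of $\gamma F:\mathcal{C}\to\mathcal{D}[\mathcal{W}^{-1}]$ along $\gamma:\mathcal{C}\to\mathcal{C}[\mathcal{W}^{-1}]$ (a right Kan extension preserved by every functor out of $\mathcal{D}[\mathcal{W}^{-1}]$). *)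

theory Defs
  imports "HOL-Library.FuncSet"
begin

section \<open>Categories, functors, natural transformations\<close>

text \<open>\<open>Comp C g f\<close> is the composite "g after f". Every HOL type is a set, so no separate
  smallness condition is needed in order to form functor categories.\<close>

record ('o, 'm) cat =
  Obj :: "'o set"
  Arr :: "'m set"
  Dom :: "'m \<Rightarrow> 'o"
  Cod :: "'m \<Rightarrow> 'o"
  Ident :: "'o \<Rightarrow> 'm"
  Comp :: "'m \<Rightarrow> 'm \<Rightarrow> 'm"

definition hom :: "('o, 'm, 'r) cat_scheme \<Rightarrow> 'o \<Rightarrow> 'o \<Rightarrow> 'm set" where
  "hom C x y = {f \<in> Arr C. Dom C f = x \<and> Cod C f = y}"

locale category =
  fixes C :: "('o, 'm, 'r) cat_scheme"
  assumes Dom_in: "f \<in> Arr C \<Longrightarrow> Dom C f \<in> Obj C"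
    and Cod_in: "f \<in> Arr C \<Longrightarrow> Cod C f \<in> Obj C"
    and Ident_in: "x \<in> Obj C \<Longrightarrow> Ident C x \<in> hom C x x"
    and Comp_in: "\<lbrakk>f \<in> hom C x y; g \<in> hom C y z\<rbrakk> \<Longrightarrow> Comp C g f \<in> hom C x z"
    and Comp_Ident: "f \<in> hom C x y \<Longrightarrow> Comp C f (Ident C x) = f"
    and Ident_Comp: "f \<in> hom C x y \<Longrightarrow> Comp C (Ident C y) f = f"
    and Comp_assoc: "\<lbrakk>f \<in> hom C x y; g \<in> hom C y z; h \<in> hom C z w\<rbrakk>
      \<Longrightarrow> Comp C h (Comp C g f) = Comp C (Comp C h g) f"

definition iso_arr :: "('o, 'm, 'r) cat_scheme \<Rightarrow> 'm \<Rightarrow> bool" where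
  "iso_arr C f \<longleftrightarrow> f \<in> Arr C \<and>
    (\<exists>g \<in> hom C (Cod C f) (Dom C f).
        Comp C g f = Ident C (Dom C f) \<and> Comp C f g = Ident C (Cod C f))"

text \<open>Functors and natural transformations are extensional (\<open>undefined\<close> off the source
  category), so that HOL equality of them is equality of functors, respectively of natural
  transformations.\<close>

record ('o, 'm, 'p, 'n) func =
  FO :: "'o \<Rightarrow> 'p"
  FM :: "'m \<Rightarrow> 'n"

definition is_functor ::
  "('o, 'm, 'r) cat_scheme \<Rightarrow> ('p, 'n, 's) cat_scheme \<Rightarrow> ('o, 'm, 'p, 'n) func \<Rightarrow> bool" where
  "is_functor C D F \<longleftrightarrow>
     FO F \<in> Obj C \<rightarrow>\<^sub>E Obj D \<and>
     FM F \<in> Arr C \<rightarrow>\<^sub>E Arr D \<and>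
     (\<forall>f \<in> Arr C. Dom D (FM F f) = FO F (Dom C f) \<and> Cod D (FM F f) = FO F (Cod C f)) \<and>
     (\<forall>x \<in> Obj C. FM F (Ident C x) = Ident D (FO F x)) \<and>
     (\<forall>f \<in> Arr C. \<forall>g \<in> Arr C. Cod C f = Dom C g \<longrightarrow>
        FM F (Comp C g f) = Comp D (FM F g) (FM F f))"

definition id_functor :: "('o, 'm, 'r) cat_scheme \<Rightarrow> ('o, 'm, 'o, 'm) func" where
  "id_functor C = \<lparr>FO = \<lambda>x \<in> Obj C. x, FM = \<lambda>f \<in> Arr C. f\<rparr>"

text \<open>\<open>comp_functor C G F\<close> is "G after F"; \<open>C\<close> is the source of \<open>F\<close>.\<close>

definition comp_functor ::
  "('o, 'm, 'r) cat_scheme \<Rightarrow> ('p, 'n, 'q, 'k) func \<Rightarrow> ('o, 'm, 'p, 'n) func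
     \<Rightarrow> ('o, 'm, 'q, 'k) func" where
  "comp_functor C G F = \<lparr>FO = \<lambda>x \<in> Obj C. FO G (FO F x), FM = \<lambda>f \<in> Arr C. FM G (FM F f)\<rparr>"

definition const_functor ::
  "('i, 'j, 'r) cat_scheme \<Rightarrow> ('o, 'm, 's) cat_scheme \<Rightarrow> 'o \<Rightarrow> ('i, 'j, 'o, 'm) func" where
  "const_functor I C x = \<lparr>FO = \<lambda>i \<in> Obj I. x, FM = \<lambda>u \<in> Arr I. Ident C x\<rparr>"

definition nat_trans ::
  "('o, 'm, 'r) cat_scheme \<Rightarrow> ('p, 'n, 's) cat_scheme
     \<Rightarrow> ('o, 'm, 'p, 'n) func \<Rightarrow> ('o, 'm, 'p, 'n) func \<Rightarrow> ('o \<Rightarrow> 'n) \<Rightarrow> bool" where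
  "nat_trans C D F G \<tau> \<longleftrightarrow>
     is_functor C D F \<and> is_functor C D G \<and>
     \<tau> \<in> extensional (Obj C) \<and>
     (\<forall>x \<in> Obj C. \<tau> x \<in> hom D (FO F x) (FO G x)) \<and>
     (\<forall>f \<in> Arr C. Comp D (FM G f) (\<tau> (Dom C f)) = Comp D (\<tau> (Cod C f)) (FM F f))"

text \<open>Arrows of functor categories carry their source and target.\<close>

type_synonym ('o, 'm, 'p, 'n) ntarr =
  "('o, 'm, 'p, 'n) func \<times> ('o \<Rightarrow> 'n) \<times> ('o, 'm, 'p, 'n) func"

definition nt_map :: "('o, 'm, 'p, 'n) ntarr \<Rightarrow> 'o \<Rightarrow> 'n" where
  "nt_map t = fst (snd t)"

section \<open>Localization\<close>

text \<open>\<open>Weq\<close> is the class of morphisms to be inverted. Saturation is imposed separately, by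
  \<open>relative_category\<close> below.\<close>

record ('o, 'm) relcat = "('o, 'm) cat" +
  Weq :: "'m set"

text \<open>The localization is the Gabriel--Zisman construction: same objects; arrows are zigzags,
  listed from source to target, of arrows of \<open>C\<close> (\<open>Fwd\<close>) and of weak equivalences
  travelled backwards (\<open>Bwd\<close>), modulo the congruence generated by \<open>zz_rel\<close>.\<close>

datatype 'm zstep = Fwd 'm | Bwd 'm

inductive zigzag :: "('o, 'm, 'r) relcat_scheme \<Rightarrow> 'o \<Rightarrow> 'm zstep list \<Rightarrow> 'o \<Rightarrow> bool"
  for C where
  zz_Nil: "x \<in> Obj C \<Longrightarrow> zigzag C x [] x"
| zz_Fwd: "\<lbrakk>f \<in> Arr C; zigzag C (Cod C f) zs y\<rbrakk> \<Longrightarrow> zigzag C (Dom C f) (Fwd f # zs) y"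
| zz_Bwd: "\<lbrakk>w \<in> Arr C; w \<in> Weq C; zigzag C (Dom C w) zs y\<rbrakk>
    \<Longrightarrow> zigzag C (Cod C w) (Bwd w # zs) y"

inductive zz_rel :: "('o, 'm, 'r) relcat_scheme \<Rightarrow> 'm zstep list \<Rightarrow> 'm zstep list \<Rightarrow> bool"
  for C where
  zr_Comp: "\<lbrakk>f \<in> Arr C; g \<in> Arr C; Cod C f = Dom C g\<rbrakk>
    \<Longrightarrow> zz_rel C [Fwd f, Fwd g] [Fwd (Comp C g f)]"
| zr_Ident: "x \<in> Obj C \<Longrightarrow> zz_rel C [Fwd (Ident C x)] []"
| zr_Fwd_Bwd: "w \<in> Weq C \<Longrightarrow> zz_rel C [Fwd w, Bwd w] []"
| zr_Bwd_Fwd: "w \<in> Weq C \<Longrightarrow> zz_rel C [Bwd w, Fwd w] []"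

inductive zz_eq ::
  "('o, 'm, 'r) relcat_scheme \<Rightarrow> 'o \<Rightarrow> 'o \<Rightarrow> 'm zstep list \<Rightarrow> 'm zstep list \<Rightarrow> bool"
  for C x y where
  ze_rel: "\<lbrakk>zz_rel C as bs; zigzag C x (us @ as @ vs) y; zigzag C x (us @ bs @ vs) y\<rbrakk>
    \<Longrightarrow> zz_eq C x y (us @ as @ vs) (us @ bs @ vs)"
| ze_refl: "zigzag C x as y \<Longrightarrow> zz_eq C x y as as"
| ze_sym: "zz_eq C x y as bs \<Longrightarrow> zz_eq C x y bs as"
| ze_trans: "\<lbrakk>zz_eq C x y as bs; zz_eq C x y bs cs\<rbrakk> \<Longrightarrow> zz_eq C x y as cs"

definition zz_class ::
  "('o, 'm, 'r) relcat_scheme \<Rightarrow> 'o \<Rightarrow> 'o \<Rightarrow> 'm zstep list \<Rightarrow> 'm zstep list set" where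
  "zz_class C x y zs = {zs'. zz_eq C x y zs zs'}"

type_synonym ('o, 'm) locarr = "'o \<times> 'm zstep list set \<times> 'o"

definition loc :: "('o, 'm, 'r) relcat_scheme \<Rightarrow> ('o, ('o, 'm) locarr) cat" where
  "loc C = \<lparr>
     Obj = Obj C,
     Arr = {(x, zz_class C x y zs, y) | x zs y. zigzag C x zs y},
     Dom = \<lambda>(x, A, y). x,
     Cod = \<lambda>(x, A, y). y,
     Ident = \<lambda>x. (x, zz_class C x x [], x),
     Comp = \<lambda>(y', B, z) (x, A, y). (x, \<Union>as \<in> A. \<Union>bs \<in> B. zz_class C x z (as @ bs), z)\<rparr>"

definition loc_gamma ::
  "('o, 'm, 'r) relcat_scheme \<Rightarrow> ('o, 'm, 'o, ('o, 'm) locarr) func" where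
  "loc_gamma C = \<lparr>
     FO = \<lambda>x \<in> Obj C. x,
     FM = \<lambda>f \<in> Arr C. (Dom C f, zz_class C (Dom C f) (Cod C f) [Fwd f], Cod C f)\<rparr>"

text \<open>The functor between localizations induced by a relative functor: apply the functor to
  every step of a zigzag.\<close>

definition loc_functor ::
  "('o, 'm, 'r) relcat_scheme \<Rightarrow> ('p, 'n, 's) relcat_scheme \<Rightarrow> ('o, 'm, 'p, 'n) func
     \<Rightarrow> ('o, ('o, 'm) locarr, 'p, ('p, 'n) locarr) func" where
  "loc_functor C D F = \<lparr>
     FO = \<lambda>x \<in> Obj (loc C). FO F x,
     FM = \<lambda>t \<in> Arr (loc C). case t of (x, A, y) \<Rightarrow>
       (FO F x, \<Union>zs \<in> A. zz_class D (FO F x) (FO F y) (map (map_zstep (FM F)) zs), FO F y)\<rparr>"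

section \<open>Relative categories and relative adjunctions\<close>

definition relative_category :: "('o, 'm, 'r) relcat_scheme \<Rightarrow> bool" where
  "relative_category C \<longleftrightarrow>
     category C \<and> Weq C = {f \<in> Arr C. iso_arr (loc C) (FM (loc_gamma C) f)}"

definition relative_functor ::
  "('o, 'm, 'r) relcat_scheme \<Rightarrow> ('p, 'n, 's) relcat_scheme \<Rightarrow> ('o, 'm, 'p, 'n) func \<Rightarrow> bool" where
  "relative_functor C D F \<longleftrightarrow> is_functor C D F \<and> (\<forall>w \<in> Weq C. FM F w \<in> Weq D)"

definition functors_on ::
  "('o, 'm, 'p, 'n) func set \<Rightarrow> ('o, 'm, 'r) cat_scheme \<Rightarrow> ('p, 'n, 's) relcat_scheme
     \<Rightarrow> (('o, 'm, 'p, 'n) func, ('o, 'm, 'p, 'n) ntarr) relcat" where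
  "functors_on S C D = \<lparr>
     Obj = S,
     Arr = {(F, \<tau>, G). F \<in> S \<and> G \<in> S \<and> nat_trans C D F G \<tau>},
     Dom = \<lambda>(F, \<tau>, G). F,
     Cod = \<lambda>(F, \<tau>, G). G,
     Ident = \<lambda>F. (F, \<lambda>x \<in> Obj C. Ident D (FO F x), F),
     Comp = \<lambda>(G', \<sigma>, H) (F, \<tau>, G). (F, \<lambda>x \<in> Obj C. Comp D (\<sigma> x) (\<tau> x), H),
     Weq = {(F, \<tau>, G). F \<in> S \<and> G \<in> S \<and> nat_trans C D F G \<tau> \<and> (\<forall>x \<in> Obj C. \<tau> x \<in> Weq D)}\<rparr>"

text \<open>The category \<open>C^I\<close> of all diagrams, and the category \<open>Fun(C, D)\<close> of relative functors,
  both with the pointwise weak equivalences. Morphisms of \<open>loc (relfun C D)\<close> are the relative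
  natural transformations.\<close>

definition diagrams ::
  "('i, 'j, 'r) cat_scheme \<Rightarrow> ('o, 'm, 's) relcat_scheme
     \<Rightarrow> (('i, 'j, 'o, 'm) func, ('i, 'j, 'o, 'm) ntarr) relcat" where
  "diagrams I C = functors_on {F. is_functor I C F} I C"

definition relfun ::
  "('o, 'm, 'r) relcat_scheme \<Rightarrow> ('p, 'n, 's) relcat_scheme
     \<Rightarrow> (('o, 'm, 'p, 'n) func, ('o, 'm, 'p, 'n) ntarr) relcat" where
  "relfun C D = functors_on {F. relative_functor C D F} C D"

text \<open>Composition with \<open>K\<close> as a functor \<open>relfun C D \<rightarrow> relfun C E\<close>, and
  composition with \<open>J : B \<rightarrow> C\<close> as a functor \<open>relfun C D \<rightarrow> relfun B D\<close>.\<close>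

definition postcomp ::
  "('o, 'm, 'r) relcat_scheme \<Rightarrow> ('p, 'n, 's) relcat_scheme \<Rightarrow> ('p, 'n, 'q, 'k) func
     \<Rightarrow> (('o, 'm, 'p, 'n) func, ('o, 'm, 'p, 'n) ntarr,
         ('o, 'm, 'q, 'k) func, ('o, 'm, 'q, 'k) ntarr) func" where
  "postcomp C D K = \<lparr>
     FO = \<lambda>F \<in> Obj (relfun C D). comp_functor C K F,
     FM = \<lambda>t \<in> Arr (relfun C D). case t of (F, \<tau>, G) \<Rightarrow>
       (comp_functor C K F, \<lambda>x \<in> Obj C. FM K (\<tau> x), comp_functor C K G)\<rparr>"

definition precomp ::
  "('b, 'a, 't) relcat_scheme \<Rightarrow> ('o, 'm, 'r) relcat_scheme \<Rightarrow> ('p, 'n, 's) relcat_scheme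
     \<Rightarrow> ('b, 'a, 'o, 'm) func
     \<Rightarrow> (('o, 'm, 'p, 'n) func, ('o, 'm, 'p, 'n) ntarr,
         ('b, 'a, 'p, 'n) func, ('b, 'a, 'p, 'n) ntarr) func" where
  "precomp B C D J = \<lparr>
     FO = \<lambda>F \<in> Obj (relfun C D). comp_functor B F J,
     FM = \<lambda>t \<in> Arr (relfun C D). case t of (F, \<tau>, G) \<Rightarrow>
       (comp_functor B F J, \<lambda>x \<in> Obj B. \<tau> (FO J x), comp_functor B G J)\<rparr>"

text \<open>Whiskering of relative natural transformations: \<open>K \<alpha>\<close> and \<open>\<alpha> J\<close>.\<close>

definition whisker_post ::
  "('o, 'm, 'r) relcat_scheme \<Rightarrow> ('p, 'n, 's) relcat_scheme \<Rightarrow> ('q, 'k, 't) relcat_scheme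
     \<Rightarrow> ('p, 'n, 'q, 'k) func
     \<Rightarrow> (('o, 'm, 'p, 'n) func, ('o, 'm, 'p, 'n) ntarr) locarr
     \<Rightarrow> (('o, 'm, 'q, 'k) func, ('o, 'm, 'q, 'k) ntarr) locarr" where
  "whisker_post C D E K = FM (loc_functor (relfun C D) (relfun C E) (postcomp C D K))"

definition whisker_pre ::
  "('b, 'a, 't) relcat_scheme \<Rightarrow> ('o, 'm, 'r) relcat_scheme \<Rightarrow> ('p, 'n, 's) relcat_scheme
     \<Rightarrow> ('b, 'a, 'o, 'm) func
     \<Rightarrow> (('o, 'm, 'p, 'n) func, ('o, 'm, 'p, 'n) ntarr) locarr
     \<Rightarrow> (('b, 'a, 'p, 'n) func, ('b, 'a, 'p, 'n) ntarr) locarr" where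
  "whisker_pre B C D J = FM (loc_functor (relfun C D) (relfun B D) (precomp B C D J))"

definition relative_adjunction ::
  "('o, 'm, 'r) relcat_scheme \<Rightarrow> ('p, 'n, 's) relcat_scheme
     \<Rightarrow> ('o, 'm, 'p, 'n) func \<Rightarrow> ('p, 'n, 'o, 'm) func
     \<Rightarrow> (('p, 'n, 'p, 'n) func, ('p, 'n, 'p, 'n) ntarr) locarr
     \<Rightarrow> (('o, 'm, 'o, 'm) func, ('o, 'm, 'o, 'm) ntarr) locarr \<Rightarrow> bool" where
  "relative_adjunction C D F G \<alpha> \<beta> \<longleftrightarrow>
     relative_functor C D F \<and> relative_functor D C G \<and>
     \<alpha> \<in> hom (loc (relfun D D)) (comp_functor D F G) (id_functor D) \<and>
     \<beta> \<in> hom (loc (relfun C C)) (id_functor C) (comp_functor C G F) \<and>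
     Comp (loc (relfun C D)) (whisker_pre C D D F \<alpha>) (whisker_post C C D F \<beta>)
       = Ident (loc (relfun C D)) F \<and>
     Comp (loc (relfun D C)) (whisker_post D D C G \<alpha>) (whisker_pre D C C G \<beta>)
       = Ident (loc (relfun D C)) G"

section \<open>Colimits and realizable homotopy colimits\<close>

definition const_diagram ::
  "('i, 'j, 'r) cat_scheme \<Rightarrow> ('o, 'm, 's) relcat_scheme
     \<Rightarrow> ('o, 'm, ('i, 'j, 'o, 'm) func, ('i, 'j, 'o, 'm) ntarr) func" where
  "const_diagram I C = \<lparr>
     FO = \<lambda>x \<in> Obj C. const_functor I C x,
     FM = \<lambda>f \<in> Arr C.
       (const_functor I C (Dom C f), \<lambda>i \<in> Obj I. f, const_functor I C (Cod C f))\<rparr>"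

definition is_colimit ::
  "('i, 'j, 'r) cat_scheme \<Rightarrow> ('o, 'm, 's) cat_scheme
     \<Rightarrow> ('i, 'j, 'o, 'm) func \<Rightarrow> 'o \<Rightarrow> ('i \<Rightarrow> 'm) \<Rightarrow> bool" where
  "is_colimit I C X L \<kappa> \<longleftrightarrow>
     L \<in> Obj C \<and> nat_trans I C X (const_functor I C L) \<kappa> \<and>
     (\<forall>M \<in> Obj C. \<forall>\<mu>. nat_trans I C X (const_functor I C M) \<mu> \<longrightarrow>
        (\<exists>!u. u \<in> hom C L M \<and> (\<forall>i \<in> Obj I. Comp C u (\<kappa> i) = \<mu> i)))"

text \<open>A colimit functor comes with its universal cocones \<open>\<eta> X : X \<rightarrow> c (colim X)\<close>, natural
  in \<open>X\<close>.\<close>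

definition colimit_functor ::
  "('i, 'j, 'r) cat_scheme \<Rightarrow> ('o, 'm, 's) relcat_scheme
     \<Rightarrow> (('i, 'j, 'o, 'm) func, ('i, 'j, 'o, 'm) ntarr, 'o, 'm) func
     \<Rightarrow> (('i, 'j, 'o, 'm) func \<Rightarrow> ('i, 'j, 'o, 'm) ntarr) \<Rightarrow> bool" where
  "colimit_functor I C K \<eta> \<longleftrightarrow>
     is_functor (diagrams I C) C K \<and>
     nat_trans (diagrams I C) (diagrams I C)
       (id_functor (diagrams I C)) (comp_functor (diagrams I C) (const_diagram I C) K) \<eta> \<and>
     (\<forall>X \<in> Obj (diagrams I C). is_colimit I C X (FO K X) (nt_map (\<eta> X)))"

definition realizable_hocolim ::
  "('i, 'j, 'r) cat_scheme \<Rightarrow> ('o, 'm, 's) relcat_scheme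
     \<Rightarrow> (('i, 'j, 'o, 'm) func, ('i, 'j, 'o, 'm) ntarr, 'o, 'm) func
     \<Rightarrow> (('o, 'm, 'o, 'm) func, ('o, 'm, 'o, 'm) ntarr) locarr
     \<Rightarrow> ((('i, 'j, 'o, 'm) func, ('i, 'j, 'o, 'm) ntarr,
            ('i, 'j, 'o, 'm) func, ('i, 'j, 'o, 'm) ntarr) func,
          (('i, 'j, 'o, 'm) func, ('i, 'j, 'o, 'm) ntarr,
            ('i, 'j, 'o, 'm) func, ('i, 'j, 'o, 'm) ntarr) ntarr) locarr
     \<Rightarrow> bool" where
  "realizable_hocolim I C hocolim \<alpha> \<beta> \<longleftrightarrow>
     relative_adjunction (diagrams I C) C hocolim (const_diagram I C) \<alpha> \<beta>"

section \<open>Kan extensions and derived functors\<close>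

text \<open>\<open>(R, \<epsilon>)\<close> is a right Kan extension of \<open>G : A \<rightarrow> E\<close> along \<open>K : A \<rightarrow> B\<close>.\<close>

definition right_kan_extension ::
  "('a, 'a1, 'r) cat_scheme \<Rightarrow> ('b, 'b1, 's) cat_scheme \<Rightarrow> ('c, 'c1, 't) cat_scheme
     \<Rightarrow> ('a, 'a1, 'b, 'b1) func \<Rightarrow> ('a, 'a1, 'c, 'c1) func
     \<Rightarrow> ('b, 'b1, 'c, 'c1) func \<Rightarrow> ('a \<Rightarrow> 'c1) \<Rightarrow> bool" where
  "right_kan_extension A B E K G R \<epsilon> \<longleftrightarrow>
     is_functor A B K \<and> is_functor A E G \<and> is_functor B E R \<and>
     nat_trans A E (comp_functor A R K) G \<epsilon> \<and>
     (\<forall>T \<tau>. is_functor B E T \<longrightarrow> nat_trans A E (comp_functor A T K) G \<tau> \<longrightarrow>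
        (\<exists>!\<sigma>. nat_trans B E T R \<sigma> \<and> (\<forall>a \<in> Obj A. Comp E (\<epsilon> a) (\<sigma> (FO K a)) = \<tau> a)))"

text \<open>Absoluteness quantifies over all categories \<open>X\<close>. As HOL cannot quantify over types inside
  a formula, the types of objects and arrows of \<open>X\<close> are parameters; a theorem in which they are
  type variables, and on which \<open>R\<close> and \<open>\<epsilon>\<close> do not depend, is about all categories.\<close>

definition absolute_right_kan_extension ::
  "'x itself \<Rightarrow> 'y itself
     \<Rightarrow> ('a, 'a1, 'r) cat_scheme \<Rightarrow> ('b, 'b1, 's) cat_scheme \<Rightarrow> ('c, 'c1, 't) cat_scheme
     \<Rightarrow> ('a, 'a1, 'b, 'b1) func \<Rightarrow> ('a, 'a1, 'c, 'c1) func
     \<Rightarrow> ('b, 'b1, 'c, 'c1) func \<Rightarrow> ('a \<Rightarrow> 'c1) \<Rightarrow> bool" where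
  "absolute_right_kan_extension TX TY A B E K G R \<epsilon> \<longleftrightarrow>
     right_kan_extension A B E K G R \<epsilon> \<and>
     (\<forall>(X :: ('x, 'y) cat) H. category X \<longrightarrow> is_functor E X H \<longrightarrow>
        right_kan_extension A B X K
          (comp_functor A H G) (comp_functor B H R) (\<lambda>a \<in> Obj A. FM H (\<epsilon> a)))"

definition absolute_left_derived_functor ::
  "'x itself \<Rightarrow> 'y itself
     \<Rightarrow> ('o, 'm, 'r) relcat_scheme \<Rightarrow> ('p, 'n, 's) relcat_scheme \<Rightarrow> ('o, 'm, 'p, 'n) func
     \<Rightarrow> ('o, ('o, 'm) locarr, 'p, ('p, 'n) locarr) func \<Rightarrow> ('o \<Rightarrow> ('p, 'n) locarr) \<Rightarrow> bool" where
  "absolute_left_derived_functor TX TY C D F L \<epsilon> \<longleftrightarrow>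
     absolute_right_kan_extension TX TY C (loc C) (loc D)
       (loc_gamma C) (comp_functor C (loc_gamma D) F) L \<epsilon>"

text \<open>The component at an object \<open>x\<close> of a relative natural transformation, an arrow of
  the localized target.\<close>

definition eval_functor ::
  "('o, 'm, 'r) relcat_scheme \<Rightarrow> ('p, 'n, 's) relcat_scheme \<Rightarrow> 'o
     \<Rightarrow> (('o, 'm, 'p, 'n) func, ('o, 'm, 'p, 'n) ntarr, 'p, 'n) func" where
  "eval_functor C D x = \<lparr>
     FO = \<lambda>F \<in> Obj (relfun C D). FO F x,
     FM = \<lambda>t \<in> Arr (relfun C D). nt_map t x\<rparr>"

definition rel_component ::
  "('o, 'm, 'r) relcat_scheme \<Rightarrow> ('p, 'n, 's) relcat_scheme
     \<Rightarrow> (('o, 'm, 'p, 'n) func, ('o, 'm, 'p, 'n) ntarr) locarr \<Rightarrow> 'o \<Rightarrow> ('p, 'n) locarr" where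
  "rel_component C D t x = FM (loc_functor (relfun C D) D (eval_functor C D x)) t"

text \<open>The comparison \<open>hocolim X \<rightarrow> colim X\<close> in the localization of \<open>C\<close>: the transpose of the
  universal cocone \<open>\<eta> X : X \<rightarrow> c (colim X)\<close> under the relative adjunction, that is
  \<open>hocolim X \<rightarrow> hocolim (c (colim X)) \<rightarrow> colim X\<close>, induced by \<open>\<eta> X\<close> and then \<open>\<alpha>\<close>.\<close>

definition hocolim_comparison ::
  "('i, 'j, 'r) cat_scheme \<Rightarrow> ('o, 'm, 's) relcat_scheme
     \<Rightarrow> (('i, 'j, 'o, 'm) func, ('i, 'j, 'o, 'm) ntarr, 'o, 'm) func
     \<Rightarrow> (('i, 'j, 'o, 'm) func \<Rightarrow> ('i, 'j, 'o, 'm) ntarr)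
     \<Rightarrow> (('i, 'j, 'o, 'm) func, ('i, 'j, 'o, 'm) ntarr, 'o, 'm) func
     \<Rightarrow> (('o, 'm, 'o, 'm) func, ('o, 'm, 'o, 'm) ntarr) locarr
     \<Rightarrow> ('i, 'j, 'o, 'm) func \<Rightarrow> ('o, 'm) locarr" where
  "hocolim_comparison I C colim \<eta> hocolim \<alpha> =
     (\<lambda>X \<in> Obj (diagrams I C).
        Comp (loc C) (rel_component C C \<alpha> (FO colim X))
          (FM (loc_gamma C) (FM hocolim (\<eta> X))))"

end

theory Submission
  imports Defs
begin

text \<open>Write \<open>c\<close> for the constant diagram functor, \<open>\<gamma>\<close> for localization functors, and \<open>L\<close> for
  the functor induced by \<open>hocolim\<close> on localizations. There are two adjunctions with right adjoint
  given by \<open>c\<close>: the adjunction \<open>colim \<stileturn> c\<close>, with unit \<open>\<eta>\<close> and counit \<open>\<kappa>\<close>, before localization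
  (\<open>colimit_adjunction\<close>), and \<open>L \<stileturn> loc c\<close>, with unit \<open>\<beta>\<close> and counit \<open>\<alpha>\<close>, after it. The second one
  is what a relative adjunction induces on localizations (\<open>adjunction_loc\<close>): a relative natural
  transformation is a zigzag of natural transformations, so it has components in the
  localized target, and these are natural on the localized source.

  Given these, the universal property is a matter of transposing twice. For
  \<open>H : loc C \<rightarrow> X\<close> and \<open>T : loc (C^I) \<rightarrow> X\<close>, transformations \<open>T \<gamma> \<rightarrow> H \<gamma> colim\<close> correspond by
  \<open>colim \<stileturn> c\<close> to transformations \<open>T \<gamma> c \<rightarrow> H \<gamma>\<close>, where \<open>\<gamma> c = (loc c) \<gamma>\<close>. A family that is natural
  on \<open>C\<close> is natural on \<open>loc C\<close> (\<open>nat_trans_on_loc\<close>), so these are the transformations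
  \<open>T (loc c) \<rightarrow> H\<close>, and by \<open>L \<stileturn> loc c\<close> they correspond to transformations \<open>T \<rightarrow> H L\<close>. The
  inverse of the composite bijection is composition with \<open>H\<close> applied to the comparison
  \<open>L X \<rightarrow> L (c (colim X)) \<rightarrow> colim X\<close>, given by \<open>\<eta>\<close> and \<open>\<alpha>\<close>. Since \<open>H\<close> is arbitrary throughout, the
  Kan extension is absolute (\<open>right_kan_extension_comparison\<close>).\<close>

section \<open>Categories, functors and natural transformations\<close>

lemma hom_iff: "f \<in> hom C x y \<longleftrightarrow> f \<in> Arr C \<and> Dom C f = x \<and> Cod C f = y"
  by (simp add: hom_def)

context category
begin

lemma Arr_Ident [simp]: "x \<in> Obj C \<Longrightarrow> Ident C x \<in> Arr C"
  and Dom_Ident [simp]: "x \<in> Obj C \<Longrightarrow> Dom C (Ident C x) = x"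
  and Cod_Ident [simp]: "x \<in> Obj C \<Longrightarrow> Cod C (Ident C x) = x"
  using Ident_in by (auto simp: hom_iff)

lemma Arr_Comp [simp]:
    "\<lbrakk>f \<in> Arr C; g \<in> Arr C; Cod C f = Dom C g\<rbrakk> \<Longrightarrow> Comp C g f \<in> Arr C"
  and Dom_Comp [simp]:
    "\<lbrakk>f \<in> Arr C; g \<in> Arr C; Cod C f = Dom C g\<rbrakk> \<Longrightarrow> Dom C (Comp C g f) = Dom C f"
  and Cod_Comp [simp]:
    "\<lbrakk>f \<in> Arr C; g \<in> Arr C; Cod C f = Dom C g\<rbrakk> \<Longrightarrow> Cod C (Comp C g f) = Cod C g"
  using Comp_in[of f "Dom C f" "Cod C f" g "Cod C g"] by (auto simp: hom_iff)

lemma Comp_Ident_Arr [simp]: "f \<in> Arr C \<Longrightarrow> Dom C f = x \<Longrightarrow> Comp C f (Ident C x) = f"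
  and Ident_Comp_Arr [simp]: "f \<in> Arr C \<Longrightarrow> Cod C f = y \<Longrightarrow> Comp C (Ident C y) f = f"
  by (rule Comp_Ident Ident_Comp, simp add: hom_iff)+

lemma hom_Obj:
  assumes "f \<in> hom C x y"
  shows "x \<in> Obj C" "y \<in> Obj C"
  using assms Dom_in Cod_in by (auto simp: hom_iff)

lemma Comp_Comp:
  "\<lbrakk>f \<in> Arr C; g \<in> Arr C; h \<in> Arr C; Cod C f = Dom C g; Cod C g = Dom C h\<rbrakk>
    \<Longrightarrow> Comp C (Comp C h g) f = Comp C h (Comp C g f)"
  using Comp_assoc[of f _ _ g _ h] by (auto simp: hom_iff)

text \<open>Here \<open>t\<close> is a section of \<open>s\<close> and \<open>t'\<close> a retraction of \<open>s'\<close>, so that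
  \<open>t' q = t' q s t = t' s' p t = p t\<close>.\<close>

lemma inverse_square:
  assumes s: "s \<in> Arr C" and t: "t \<in> Arr C" and s': "s' \<in> Arr C" and t': "t' \<in> Arr C"
    and p: "p \<in> hom C (Dom C s) (Dom C s')" and q: "q \<in> hom C (Cod C s) (Cod C s')"
    and st: "Dom C t = Cod C s" "Cod C t = Dom C s" "Dom C t' = Cod C s'" "Cod C t' = Dom C s'"
    and inv: "Comp C s t = Ident C (Cod C s)" "Comp C t' s' = Ident C (Dom C s')"
    and sq: "Comp C s' p = Comp C q s"
  shows "Comp C t' q = Comp C p t"
proof -
  note [simp] = s t s' t' st and [simp] = p[unfolded hom_iff] q[unfolded hom_iff]
  have "Comp C t' q = Comp C t' (Comp C q (Comp C s t))"
    by (simp add: inv)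
  also have "\<dots> = Comp C t' (Comp C (Comp C s' p) t)"
    by (simp add: sq Comp_Comp)
  also have "\<dots> = Comp C (Comp C t' s') (Comp C p t)"
    by (simp add: Comp_Comp)
  also have "\<dots> = Comp C p t"
    by (simp add: inv)
  finally show ?thesis .
qed

end

lemma is_functorI:
  assumes "FO F \<in> extensional (Obj C)" "FM F \<in> extensional (Arr C)"
    and "\<And>x. x \<in> Obj C \<Longrightarrow> FO F x \<in> Obj D"
    and "\<And>f. f \<in> Arr C \<Longrightarrow> FM F f \<in> hom D (FO F (Dom C f)) (FO F (Cod C f))"
    and "\<And>x. x \<in> Obj C \<Longrightarrow> FM F (Ident C x) = Ident D (FO F x)"
    and "\<And>f g. f \<in> Arr C \<Longrightarrow> g \<in> Arr C \<Longrightarrow> Cod C f = Dom C g \<Longrightarrow>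
      FM F (Comp C g f) = Comp D (FM F g) (FM F f)"
  shows "is_functor C D F"
  using assms by (auto simp: is_functor_def PiE_def hom_iff)

lemma
  assumes "is_functor C D F"
  shows functor_Obj: "x \<in> Obj C \<Longrightarrow> FO F x \<in> Obj D"
    and functor_Arr: "f \<in> Arr C \<Longrightarrow> FM F f \<in> Arr D"
    and functor_Dom: "f \<in> Arr C \<Longrightarrow> Dom D (FM F f) = FO F (Dom C f)"
    and functor_Cod: "f \<in> Arr C \<Longrightarrow> Cod D (FM F f) = FO F (Cod C f)"
    and functor_Ident: "x \<in> Obj C \<Longrightarrow> FM F (Ident C x) = Ident D (FO F x)"
    and functor_Comp: "f \<in> Arr C \<Longrightarrow> g \<in> Arr C \<Longrightarrow> Cod C f = Dom C g \<Longrightarrow>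
      FM F (Comp C g f) = Comp D (FM F g) (FM F f)"
    and functor_ext_Obj: "FO F \<in> extensional (Obj C)"
    and functor_ext_Arr: "FM F \<in> extensional (Arr C)"
  using assms by (auto simp: is_functor_def PiE_def)

lemma functor_hom: "is_functor C D F \<Longrightarrow> f \<in> hom C x y \<Longrightarrow> FM F f \<in> hom D (FO F x) (FO F y)"
  by (auto simp: hom_iff is_functor_def)

lemmas functor_simps = functor_Obj functor_Arr functor_Dom functor_Cod

lemma is_functor_comp:
  assumes C: "category C" and F: "is_functor C D F" and G: "is_functor D E G"
  shows "is_functor C E (comp_functor C G F)"
proof -
  interpret category C by (rule C)
  show ?thesis
    by (rule is_functorI)
      (auto simp: comp_functor_def hom_iff Dom_in Cod_in functor_simps[OF F] functor_simps[OF G]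
        functor_Ident[OF F] functor_Ident[OF G] functor_Comp[OF F] functor_Comp[OF G])
qed

lemma is_functor_id:
  assumes C: "category C"
  shows "is_functor C C (id_functor C)"
proof -
  interpret category C by (rule C)
  show ?thesis
    by (rule is_functorI) (auto simp: id_functor_def hom_iff Dom_in Cod_in)
qed

lemma func_eqI: "FO F = FO G \<Longrightarrow> FM F = FM G \<Longrightarrow> F = (G :: ('o, 'm, 'p, 'n) func)"
  by (cases F; cases G) simp

lemma comp_id_functor:
  assumes C: "category C" and F: "is_functor C D F"
  shows "comp_functor C (id_functor D) F = F"
proof (rule func_eqI)
  show "FO (comp_functor C (id_functor D) F) = FO F"
    using functor_ext_Obj[OF F]
    by (auto simp: comp_functor_def id_functor_def functor_Obj[OF F] extensional_def)
  show "FM (comp_functor C (id_functor D) F) = FM F"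
    using functor_ext_Arr[OF F]
    by (auto simp: comp_functor_def id_functor_def functor_Arr[OF F] extensional_def)
qed

lemma
  assumes "nat_trans C D F G \<tau>"
  shows nat_trans_functors: "is_functor C D F" "is_functor C D G"
    and nat_trans_ext: "\<tau> \<in> extensional (Obj C)"
    and nat_trans_hom: "x \<in> Obj C \<Longrightarrow> \<tau> x \<in> hom D (FO F x) (FO G x)"
    and nat_trans_square:
      "f \<in> Arr C \<Longrightarrow> Comp D (FM G f) (\<tau> (Dom C f)) = Comp D (\<tau> (Cod C f)) (FM F f)"
  using assms by (auto simp: nat_trans_def)

section \<open>Arrows of the localization\<close>

inductive_simps zigzag_Nil [simp]: "zigzag C x [] y"
inductive_simps zigzag_Fwd [simp]: "zigzag C x (Fwd f # zs) y"
inductive_simps zigzag_Bwd [simp]: "zigzag C x (Bwd w # zs) y"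

lemma zz_eq_zigzag: "zz_eq C x y as bs \<Longrightarrow> zigzag C x as y \<and> zigzag C x bs y"
  by (induction rule: zz_eq.induct) auto

lemma zz_class_eq: "zz_eq C x y as bs \<Longrightarrow> zz_class C x y as = zz_class C x y bs"
  unfolding zz_class_def by (blast intro: ze_sym ze_trans)

definition zz_arr :: "('o, 'm, 'r) relcat_scheme \<Rightarrow> 'o \<Rightarrow> 'm zstep list \<Rightarrow> 'o \<Rightarrow> ('o, 'm) locarr"
  where "zz_arr C x zs y = (x, zz_class C x y zs, y)"

lemma zz_arr_eq: "zz_eq C x y as bs \<Longrightarrow> zz_arr C x as y = zz_arr C x bs y"
  by (simp add: zz_arr_def zz_class_eq)

lemma Obj_loc [simp]: "Obj (loc C) = Obj C"
  and Dom_zz_arr [simp]: "Dom (loc C) (zz_arr C x zs y) = x"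
  and Cod_zz_arr [simp]: "Cod (loc C) (zz_arr C x zs y) = y"
  and Ident_loc: "Ident (loc C) x = zz_arr C x [] x"
  and Arr_zz_arr [simp]: "zigzag C x zs y \<Longrightarrow> zz_arr C x zs y \<in> Arr (loc C)"
  by (auto simp: loc_def zz_arr_def)

lemma Arr_locE:
  assumes "t \<in> Arr (loc C)"
  obtains x zs y where "zigzag C x zs y" "t = zz_arr C x zs y"
  using assms by (auto simp: loc_def zz_arr_def)

lemma FO_gamma: "x \<in> Obj C \<Longrightarrow> FO (loc_gamma C) x = x"
  and FM_gamma: "f \<in> Arr C \<Longrightarrow> FM (loc_gamma C) f = zz_arr C (Dom C f) [Fwd f] (Cod C f)"
  by (auto simp: loc_gamma_def zz_arr_def)

lemma zigzag_Obj:
  assumes "category C"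
  shows "zigzag C x zs y \<Longrightarrow> x \<in> Obj C \<and> y \<in> Obj C"
  by (induction rule: zigzag.induct) (auto simp: category.Dom_in[OF assms] category.Cod_in[OF assms])

lemma zigzag_append:
  assumes "category C"
  shows "zigzag C x (us @ vs) y \<longleftrightarrow> (\<exists>z. zigzag C x us z \<and> zigzag C z vs y)"
proof (induction us arbitrary: x)
  case Nil
  show ?case using zigzag_Obj[OF assms] by auto
next
  case (Cons s us)
  show ?case by (cases s) (auto simp: Cons.IH)
qed

lemma zigzag_appendI:
  assumes "category C" "zigzag C x us y" "zigzag C y vs z"
  shows "zigzag C x (us @ vs) z"
  unfolding zigzag_append[OF assms(1)] using assms(2,3) by blast

text \<open>Concatenation of zigzags is compatible with the congruence; hence the composite in the
  localization can be computed on any two representatives.\<close>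

lemma zz_eq_append:
  assumes C: "category C"
  shows "zz_eq C x y as as' \<Longrightarrow> zz_eq C y z bs bs' \<Longrightarrow> zz_eq C x z (as @ bs) (as' @ bs')"
proof -
  have L: "zz_eq C x y as as' \<Longrightarrow> zigzag C y bs z \<Longrightarrow> zz_eq C x z (as @ bs) (as' @ bs)" for as as' bs
  proof (induction rule: zz_eq.induct)
    case (ze_rel as bs' us vs)
    then have "zigzag C x (us @ as @ (vs @ bs)) z" "zigzag C x (us @ bs' @ (vs @ bs)) z"
      by (auto simp: zigzag_append[OF C])
    from zz_eq.ze_rel[OF ze_rel(1) this] show ?case by simp
  next
    case (ze_refl as)
    then show ?case by (auto intro!: zz_eq.ze_refl simp: zigzag_append[OF C])
  qed (auto intro: zz_eq.ze_sym zz_eq.ze_trans)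
  have R: "zz_eq C y z bs bs' \<Longrightarrow> zigzag C x as y \<Longrightarrow> zz_eq C x z (as @ bs) (as @ bs')" for bs bs' as
  proof (induction rule: zz_eq.induct)
    case (ze_rel bs bs' us vs)
    then have "zigzag C x ((as @ us) @ bs @ vs) z" "zigzag C x ((as @ us) @ bs' @ vs) z"
      by (auto simp: zigzag_append[OF C])
    from zz_eq.ze_rel[OF ze_rel(1) this] show ?case by simp
  next
    case (ze_refl as)
    then show ?case by (auto intro!: zz_eq.ze_refl simp: zigzag_append[OF C])
  qed (auto intro: zz_eq.ze_sym zz_eq.ze_trans)
  assume "zz_eq C x y as as'" "zz_eq C y z bs bs'"
  then show ?thesis
    using L R zz_eq_zigzag by (meson zz_eq.ze_trans)
qed

lemma Comp_zz_arr:
  assumes C: "category C" and "zigzag C x as y" "zigzag C y bs z"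
  shows "Comp (loc C) (zz_arr C y bs z) (zz_arr C x as y) = zz_arr C x (as @ bs) z"
proof -
  have "(\<Union>as' \<in> zz_class C x y as. \<Union>bs' \<in> zz_class C y z bs. zz_class C x z (as' @ bs')) =
      zz_class C x z (as @ bs)" (is "?U = ?K")
  proof -
    have "zz_class C x z (as' @ bs') = ?K"
      if "as' \<in> zz_class C x y as" "bs' \<in> zz_class C y z bs" for as' bs'
      using that zz_class_eq[OF zz_eq_append[OF C]] unfolding zz_class_def by blast
    moreover have "as \<in> zz_class C x y as" "bs \<in> zz_class C y z bs"
      using assms by (auto simp: zz_class_def intro: zz_eq.ze_refl)
    ultimately show ?thesis by blast
  qed
  then show ?thesis by (simp add: loc_def zz_arr_def)
qed

lemma category_loc:
  assumes C: "category C"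
  shows "category (loc C)"
proof -
  interpret category C by (rule C)
  note comp = Comp_zz_arr[OF C]
  show ?thesis
  proof
    fix f x y z w g h
    show "f \<in> Arr (loc C) \<Longrightarrow> Dom (loc C) f \<in> Obj (loc C)"
      and "f \<in> Arr (loc C) \<Longrightarrow> Cod (loc C) f \<in> Obj (loc C)"
      by (auto elim!: Arr_locE dest: zigzag_Obj[OF C])
    show "x \<in> Obj (loc C) \<Longrightarrow> Ident (loc C) x \<in> hom (loc C) x x"
      by (auto simp: hom_iff Ident_loc)
    show "f \<in> hom (loc C) x y \<Longrightarrow> Comp (loc C) f (Ident (loc C) x) = f"
      and "f \<in> hom (loc C) x y \<Longrightarrow> Comp (loc C) (Ident (loc C) y) f = f"
    proof -
      have "Comp (loc C) (zz_arr C x zs y) (zz_arr C x [] x) = zz_arr C x zs y"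
        "Comp (loc C) (zz_arr C y [] y) (zz_arr C x zs y) = zz_arr C x zs y"
        if "zigzag C x zs y" for zs
        using that zigzag_Obj[OF C that] by (simp_all add: comp)
      then show "f \<in> hom (loc C) x y \<Longrightarrow> Comp (loc C) f (Ident (loc C) x) = f"
        and "f \<in> hom (loc C) x y \<Longrightarrow> Comp (loc C) (Ident (loc C) y) f = f"
        by (auto simp: hom_iff Ident_loc elim!: Arr_locE)
    qed
    show "f \<in> hom (loc C) x y \<Longrightarrow> g \<in> hom (loc C) y z \<Longrightarrow> Comp (loc C) g f \<in> hom (loc C) x z"
      by (auto simp: hom_iff comp intro!: Arr_zz_arr zigzag_appendI[OF C] elim!: Arr_locE)
    assume "f \<in> hom (loc C) x y" "g \<in> hom (loc C) y z" "h \<in> hom (loc C) z w"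
    then obtain as bs cs where
      z: "zigzag C x as y" "f = zz_arr C x as y" "zigzag C y bs z" "g = zz_arr C y bs z"
        "zigzag C z cs w" "h = zz_arr C z cs w"
      by (auto simp: hom_iff elim!: Arr_locE)
    have "zigzag C x (as @ bs) z" "zigzag C y (bs @ cs) w"
      using z by (auto intro: zigzag_appendI[OF C])
    with z show "Comp (loc C) h (Comp (loc C) g f) = Comp (loc C) (Comp (loc C) h g) f"
      by (simp add: comp)
  qed
qed

lemma is_functor_gamma:
  assumes C: "category C"
  shows "is_functor C (loc C) (loc_gamma C)"
proof -
  interpret category C by (rule C)
  show ?thesis
  proof (rule is_functorI)
    show "FO (loc_gamma C) \<in> extensional (Obj C)" "FM (loc_gamma C) \<in> extensional (Arr C)"
      by (auto simp: loc_gamma_def)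
    show "FO (loc_gamma C) x \<in> Obj (loc C)" if "x \<in> Obj C" for x
      using that by (simp add: FO_gamma)
    show "FM (loc_gamma C) f \<in> hom (loc C) (FO (loc_gamma C) (Dom C f)) (FO (loc_gamma C) (Cod C f))"
      if "f \<in> Arr C" for f
      using that by (auto simp: hom_iff FM_gamma FO_gamma Dom_in Cod_in)
    show "FM (loc_gamma C) (Ident C x) = Ident (loc C) (FO (loc_gamma C) x)" if x: "x \<in> Obj C" for x
    proof -
      have "zz_eq C x x ([] @ [Fwd (Ident C x)] @ []) ([] @ [] @ [])"
        using x by (intro zz_eq.ze_rel zz_rel.zr_Ident) auto
      then show ?thesis
        using x by (simp add: FM_gamma FO_gamma Ident_loc zz_arr_eq)
    qed
    show "FM (loc_gamma C) (Comp C g f) = Comp (loc C) (FM (loc_gamma C) g) (FM (loc_gamma C) f)"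
      if fg: "f \<in> Arr C" "g \<in> Arr C" "Cod C f = Dom C g" for f g
    proof -
      have "zz_eq C (Dom C f) (Cod C g) ([] @ [Fwd f, Fwd g] @ []) ([] @ [Fwd (Comp C g f)] @ [])"
        using fg by (intro zz_eq.ze_rel zz_rel.zr_Comp) (auto simp: Dom_in Cod_in)
      then have "zz_arr C (Dom C f) [Fwd f, Fwd g] (Cod C g) =
          zz_arr C (Dom C f) [Fwd (Comp C g f)] (Cod C g)"
        by (simp add: zz_arr_eq)
      moreover have "Comp (loc C) (zz_arr C (Cod C f) [Fwd g] (Cod C g))
          (zz_arr C (Dom C f) [Fwd f] (Cod C f)) = zz_arr C (Dom C f) ([Fwd f] @ [Fwd g]) (Cod C g)"
        using fg by (intro Comp_zz_arr[OF C]) (auto simp: Dom_in Cod_in)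
      ultimately show ?thesis
        using fg by (simp add: FM_gamma)
    qed
  qed
qed

text \<open>A zigzag is a composite of forward steps, which are images under \<open>\<gamma>\<close>, and of backward
  steps, which are inverse to images under \<open>\<gamma>\<close>. So the localization is generated by the image of
  \<open>\<gamma>\<close> under composition and inversion.\<close>

lemma loc_arr_induct [consumes 2, case_names Ident gamma Comp inverse]:
  assumes C: "category C" and t: "t \<in> Arr (loc C)"
    and Id: "\<And>x. x \<in> Obj C \<Longrightarrow> P (Ident (loc C) x)"
    and ga: "\<And>f. f \<in> Arr C \<Longrightarrow> P (FM (loc_gamma C) f)"
    and co: "\<And>s t. \<lbrakk>s \<in> Arr (loc C); t \<in> Arr (loc C); Cod (loc C) s = Dom (loc C) t; P s; P t\<rbrakk>
      \<Longrightarrow> P (Comp (loc C) t s)"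
    and inv: "\<And>s t. \<lbrakk>s \<in> Arr (loc C); t \<in> hom (loc C) (Cod (loc C) s) (Dom (loc C) s);
        Comp (loc C) t s = Ident (loc C) (Dom (loc C) s);
        Comp (loc C) s t = Ident (loc C) (Cod (loc C) s); P s\<rbrakk> \<Longrightarrow> P t"
  shows "P t"
proof -
  interpret category C by (rule C)
  have "P (zz_arr C x zs y)" if "zigzag C x zs y" for x zs y
    using that
  proof (induction rule: zigzag.induct)
    case (zz_Nil x)
    then show ?case using Id by (simp add: Ident_loc)
  next
    case (zz_Fwd f zs y)
    have "Comp (loc C) (zz_arr C (Cod C f) zs y) (zz_arr C (Dom C f) [Fwd f] (Cod C f)) =
        zz_arr C (Dom C f) ([Fwd f] @ zs) y"
      using zz_Fwd by (intro Comp_zz_arr[OF C]) (auto simp: Cod_in)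
    moreover have "P (Comp (loc C) (zz_arr C (Cod C f) zs y) (zz_arr C (Dom C f) [Fwd f] (Cod C f)))"
      using zz_Fwd ga[of f] by (intro co) (auto simp: Cod_in FM_gamma)
    ultimately show ?case by simp
  next
    case (zz_Bwd w zs y)
    let ?s = "zz_arr C (Dom C w) [Fwd w] (Cod C w)" and ?t = "zz_arr C (Cod C w) [Bwd w] (Dom C w)"
    have "zz_eq C (Dom C w) (Dom C w) ([] @ [Fwd w, Bwd w] @ []) ([] @ [] @ [])"
      "zz_eq C (Cod C w) (Cod C w) ([] @ [Bwd w, Fwd w] @ []) ([] @ [] @ [])"
      using zz_Bwd by (intro zz_eq.ze_rel zz_rel.intros; simp add: Dom_in Cod_in)+
    moreover have "Comp (loc C) ?t ?s = zz_arr C (Dom C w) ([Fwd w] @ [Bwd w]) (Dom C w)"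
      "Comp (loc C) ?s ?t = zz_arr C (Cod C w) ([Bwd w] @ [Fwd w]) (Cod C w)"
      using zz_Bwd by (intro Comp_zz_arr[OF C]; simp add: Dom_in Cod_in)+
    ultimately have "Comp (loc C) ?t ?s = Ident (loc C) (Dom C w)"
      "Comp (loc C) ?s ?t = Ident (loc C) (Cod C w)"
      by (simp_all add: Ident_loc zz_arr_eq)
    moreover have "P ?s" using zz_Bwd ga[of w] by (simp add: FM_gamma)
    ultimately have "P ?t"
      using zz_Bwd by (intro inv[of ?s ?t]) (auto simp: hom_iff Dom_in Cod_in)
    moreover have "Comp (loc C) (zz_arr C (Dom C w) zs y) ?t = zz_arr C (Cod C w) ([Bwd w] @ zs) y"
      using zz_Bwd by (intro Comp_zz_arr[OF C]) (auto simp: Dom_in)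
    moreover have "P (Comp (loc C) (zz_arr C (Dom C w) zs y) ?t)" if "P ?t"
      using zz_Bwd that by (intro co) (auto simp: Dom_in)
    ultimately show ?case by simp
  qed
  with t show ?thesis by (auto elim: Arr_locE)
qed

text \<open>Naturality squares can be pasted and, for invertible arrows, reversed, so a family of
  arrows which is natural on \<open>C\<close> is automatically natural on the localization.\<close>

lemma nat_trans_on_loc:
  assumes C: "category C" and E: "category E"
    and S: "is_functor (loc C) E S" and T: "is_functor (loc C) E T"
    and ext: "\<tau> \<in> extensional (Obj C)"
    and \<tau>: "\<And>x. x \<in> Obj C \<Longrightarrow> \<tau> x \<in> hom E (FO S x) (FO T x)"
    and nat: "\<And>f. f \<in> Arr C \<Longrightarrow>
      Comp E (FM T (FM (loc_gamma C) f)) (\<tau> (Dom C f)) =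
      Comp E (\<tau> (Cod C f)) (FM S (FM (loc_gamma C) f))"
  shows "nat_trans (loc C) E S T \<tau>"
proof -
  interpret E: category E by (rule E)
  interpret L: category "loc C" by (rule category_loc[OF C])
  note [simp] = functor_simps[OF S] functor_simps[OF T]
    functor_Ident[OF S] functor_Ident[OF T] functor_Comp[OF S] functor_Comp[OF T]
  have [simp]: "\<tau> x \<in> Arr E" "Dom E (\<tau> x) = FO S x" "Cod E (\<tau> x) = FO T x" if "x \<in> Obj C" for x
    using \<tau>[OF that] by (auto simp: hom_iff)
  have [simp]: "Dom (loc C) t \<in> Obj C" "Cod (loc C) t \<in> Obj C" if "t \<in> Arr (loc C)" for t
    using L.Dom_in L.Cod_in that by auto
  have "Comp E (FM T t) (\<tau> (Dom (loc C) t)) = Comp E (\<tau> (Cod (loc C) t)) (FM S t)"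
    if "t \<in> Arr (loc C)" for t
    using C that
  proof (induction rule: loc_arr_induct)
    case (Ident x)
    then show ?case by simp
  next
    case (gamma f)
    then show ?case using nat by (simp add: FM_gamma)
  next
    case (Comp s t)
    have "Comp E (FM T (Comp (loc C) t s)) (\<tau> (Dom (loc C) s)) =
        Comp E (FM T t) (Comp E (\<tau> (Cod (loc C) s)) (FM S s))"
      using Comp by (simp add: E.Comp_Comp)
    also have "\<dots> = Comp E (Comp E (FM T t) (\<tau> (Dom (loc C) t))) (FM S s)"
      using Comp(1-3) by (simp add: E.Comp_Comp)
    also have "\<dots> = Comp E (Comp E (\<tau> (Cod (loc C) t)) (FM S t)) (FM S s)"
      by (simp only: Comp)
    also have "\<dots> = Comp E (\<tau> (Cod (loc C) t)) (FM S (Comp (loc C) t s))"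
      using Comp(1-3) by (simp add: E.Comp_Comp)
    finally show ?case using Comp by simp
  next
    case (inverse s t)
    have t: "t \<in> Arr (loc C)" "Dom (loc C) t = Cod (loc C) s" "Cod (loc C) t = Dom (loc C) s"
      using inverse by (auto simp: hom_iff)
    have "Comp E (FM S s) (FM S t) = Ident E (FO S (Cod (loc C) s))"
      "Comp E (FM T t) (FM T s) = Ident E (FO T (Dom (loc C) s))"
      using inverse t functor_Comp[OF S, of t s, symmetric] functor_Comp[OF T, of s t, symmetric]
      by simp_all
    then show ?case
      unfolding t(2,3) using inverse(1) t inverse(5)
      by - (rule E.inverse_square[where s = "FM S s" and s' = "FM T s"], simp_all add: hom_iff)
  qed
  then show ?thesis
    unfolding nat_trans_def Obj_loc using S T ext \<tau> by blast
qed

section \<open>Functors between localizations\<close>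

lemma relative_functor_functor: "relative_functor C D F \<Longrightarrow> is_functor C D F"
  by (simp add: relative_functor_def)

lemma zigzag_map:
  assumes F: "relative_functor C D F"
  shows "zigzag C x zs y \<Longrightarrow> zigzag D (FO F x) (map (map_zstep (FM F)) zs) (FO F y)"
proof (induction rule: zigzag.induct)
  note F' = relative_functor_functor[OF F]
  note [simp] = functor_simps[OF F']
  have [simp]: "w \<in> Weq C \<Longrightarrow> FM F w \<in> Weq D" for w
    using F by (simp add: relative_functor_def)
  case (zz_Nil x)
  then show ?case by simp
next
  note F' = relative_functor_functor[OF F]
  case (zz_Fwd f zs y)
  then show ?case by (simp add: functor_simps[OF F'])
next
  note F' = relative_functor_functor[OF F]
  case (zz_Bwd w zs y)
  then show ?case using F by (simp add: functor_simps[OF F'] relative_functor_def)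
qed

lemma zz_rel_map:
  assumes F: "relative_functor C D F"
  shows "zz_rel C as bs \<Longrightarrow> zz_rel D (map (map_zstep (FM F)) as) (map (map_zstep (FM F)) bs)"
proof (induction rule: zz_rel.induct)
  note F' = relative_functor_functor[OF F]
  case (zr_Comp f g)
  then show ?case
    using zz_rel.zr_Comp[of "FM F f" D "FM F g"] by (simp add: functor_simps[OF F'] functor_Comp[OF F'])
next
  note F' = relative_functor_functor[OF F]
  case (zr_Ident x)
  then show ?case
    using zz_rel.zr_Ident[of "FO F x" D] by (simp add: functor_simps[OF F'] functor_Ident[OF F'])
qed (use F in \<open>auto simp: relative_functor_def intro: zz_rel.intros\<close>)

lemma zz_eq_map:
  assumes F: "relative_functor C D F"
  shows "zz_eq C x y as bs \<Longrightarrow>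
    zz_eq D (FO F x) (FO F y) (map (map_zstep (FM F)) as) (map (map_zstep (FM F)) bs)"
proof (induction rule: zz_eq.induct)
  case (ze_rel as bs us vs)
  then show ?case
    using zz_eq.ze_rel[OF zz_rel_map[OF F ze_rel(1)]] zigzag_map[OF F ze_rel(2)]
      zigzag_map[OF F ze_rel(3)] by simp
next
  case (ze_refl as)
  then show ?case using zigzag_map[OF F] by (auto intro: zz_eq.ze_refl)
qed (auto intro: zz_eq.ze_sym zz_eq.ze_trans)

lemma FM_loc_functor:
  assumes F: "relative_functor C D F" and z: "zigzag C x zs y"
  shows "FM (loc_functor C D F) (zz_arr C x zs y) =
    zz_arr D (FO F x) (map (map_zstep (FM F)) zs) (FO F y)"
proof -
  let ?m = "map (map_zstep (FM F))"
  have "zz_class D (FO F x) (FO F y) (?m zs') = zz_class D (FO F x) (FO F y) (?m zs)"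
    if "zs' \<in> zz_class C x y zs" for zs'
    using that zz_class_eq[OF zz_eq_map[OF F]] by (auto simp: zz_class_def)
  moreover have "zs \<in> zz_class C x y zs"
    using z by (auto simp: zz_class_def intro: zz_eq.ze_refl)
  ultimately have "(\<Union>zs' \<in> zz_class C x y zs. zz_class D (FO F x) (FO F y) (?m zs')) =
      zz_class D (FO F x) (FO F y) (?m zs)"
    by blast
  moreover have "(x, zz_class C x y zs, y) \<in> Arr (loc C)"
    using Arr_zz_arr[OF z] by (simp add: zz_arr_def)
  ultimately show ?thesis
    by (simp add: loc_functor_def zz_arr_def)
qed

lemma FO_loc_functor: "x \<in> Obj C \<Longrightarrow> FO (loc_functor C D F) x = FO F x"
  by (simp add: loc_functor_def)

lemma is_functor_loc:
  assumes C: "category C" and D: "category D" and F: "relative_functor C D F"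
  shows "is_functor (loc C) (loc D) (loc_functor C D F)"
proof -
  interpret category C by (rule C)
  note F' = relative_functor_functor[OF F]
  show ?thesis
  proof (rule is_functorI)
    show "FO (loc_functor C D F) \<in> extensional (Obj (loc C))"
      "FM (loc_functor C D F) \<in> extensional (Arr (loc C))"
      by (auto simp: loc_functor_def)
    show "FO (loc_functor C D F) x \<in> Obj (loc D)" if "x \<in> Obj (loc C)" for x
      using that by (simp add: FO_loc_functor functor_simps[OF F'])
    show "FM (loc_functor C D F) t \<in> hom (loc D) (FO (loc_functor C D F) (Dom (loc C) t))
      (FO (loc_functor C D F) (Cod (loc C) t))" if t: "t \<in> Arr (loc C)" for t
    proof -
      obtain x zs y where z: "zigzag C x zs y" "t = zz_arr C x zs y"
        using t by (rule Arr_locE)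
      then show ?thesis using zigzag_Obj[OF C z(1)]
        by (simp add: FM_loc_functor[OF F] FO_loc_functor zigzag_map[OF F] hom_iff)
    qed
    show "FM (loc_functor C D F) (Ident (loc C) x) = Ident (loc D) (FO (loc_functor C D F) x)"
      if "x \<in> Obj (loc C)" for x
      using that by (simp add: Ident_loc FM_loc_functor[OF F] FO_loc_functor)
    show "FM (loc_functor C D F) (Comp (loc C) t s) =
        Comp (loc D) (FM (loc_functor C D F) t) (FM (loc_functor C D F) s)"
      if st: "s \<in> Arr (loc C)" "t \<in> Arr (loc C)" "Cod (loc C) s = Dom (loc C) t" for s t
    proof -
      obtain x as y bs z where z: "zigzag C x as y" "s = zz_arr C x as y"
          "zigzag C y bs z" "t = zz_arr C y bs z"
        using st by (auto elim!: Arr_locE)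
      moreover have "zigzag C x (as @ bs) z" using z zigzag_append[OF C] by blast
      ultimately show ?thesis
        by (simp add: Comp_zz_arr[OF C] Comp_zz_arr[OF D] FM_loc_functor[OF F] zigzag_map[OF F])
    qed
  qed
qed

lemma loc_functor_gamma:
  assumes C: "category C" and F: "relative_functor C D F" and f: "f \<in> Arr C"
  shows "FM (loc_functor C D F) (FM (loc_gamma C) f) = FM (loc_gamma D) (FM F f)"
proof -
  interpret category C by (rule C)
  note F' = relative_functor_functor[OF F]
  show ?thesis using f FM_loc_functor[OF F, of "Dom C f" "[Fwd f]" "Cod C f"]
    by (simp add: FM_gamma functor_simps[OF F'] Cod_in)
qed

text \<open>Composite functors are undefined off the arrows of \<open>C\<close>. This is why weak
  equivalences of \<open>C\<close> are required to be arrows here, and below wherever functors are composed.\<close>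

lemma loc_functor_comp:
  assumes C: "category C" and D: "category D" and F: "relative_functor C D F"
    and G: "relative_functor D E G" and t: "t \<in> Arr (loc C)"
    and W: "Weq C \<subseteq> Arr C"
  shows "FM (loc_functor D E G) (FM (loc_functor C D F) t) =
    FM (loc_functor C E (comp_functor C G F)) t"
proof -
  interpret category C by (rule C)
  note F' = relative_functor_functor[OF F] and G' = relative_functor_functor[OF G]
  obtain x zs y where z: "zigzag C x zs y" "t = zz_arr C x zs y"
    using t by (rule Arr_locE)
  let ?GF = "comp_functor C G F"
  have GF: "relative_functor C E ?GF"
    using F G is_functor_comp[OF C F' G'] W by (auto simp: relative_functor_def comp_functor_def)
  have "map (map_zstep (FM ?GF)) zs = map (map_zstep (FM G)) (map (map_zstep (FM F)) zs)"
    using z(1) by (induction rule: zigzag.induct) (auto simp: comp_functor_def)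
  moreover have "FO ?GF x = FO G (FO F x)" "FO ?GF y = FO G (FO F y)"
    using zigzag_Obj[OF C z(1)] by (auto simp: comp_functor_def)
  ultimately show ?thesis
    using z by (simp add: FM_loc_functor[OF F] FM_loc_functor[OF GF] FM_loc_functor[OF G]
        zigzag_map[OF F] del: map_map map_eq_conv)
qed

section \<open>Relative natural transformations and their components\<close>

lemma nat_trans_comp:
  assumes C: "category C" and D: "category D"
    and \<tau>: "nat_trans C D F G \<tau>" and \<sigma>: "nat_trans C D G H \<sigma>"
  shows "nat_trans C D F H (\<lambda>x \<in> Obj C. Comp D (\<sigma> x) (\<tau> x))"
proof -
  interpret C: category C by (rule C)
  interpret D: category D by (rule D)
  have F: "is_functor C D F" and G: "is_functor C D G" and H: "is_functor C D H"
    using nat_trans_functors \<tau> \<sigma> by blast+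
  note [simp] = C.Dom_in C.Cod_in functor_simps[OF F] functor_simps[OF G] functor_simps[OF H]
    nat_trans_hom[OF \<tau>, unfolded hom_iff] nat_trans_hom[OF \<sigma>, unfolded hom_iff]
  have "Comp D (FM H f) (Comp D (\<sigma> (Dom C f)) (\<tau> (Dom C f))) =
      Comp D (Comp D (\<sigma> (Cod C f)) (\<tau> (Cod C f))) (FM F f)" if f: "f \<in> Arr C" for f
  proof -
    have "Comp D (FM H f) (Comp D (\<sigma> (Dom C f)) (\<tau> (Dom C f))) =
        Comp D (Comp D (FM H f) (\<sigma> (Dom C f))) (\<tau> (Dom C f))"
      using f by (simp add: D.Comp_Comp)
    also have "\<dots> = Comp D (\<sigma> (Cod C f)) (Comp D (FM G f) (\<tau> (Dom C f)))"
      unfolding nat_trans_square[OF \<sigma> f] using f by (simp add: D.Comp_Comp)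
    also have "\<dots> = Comp D (Comp D (\<sigma> (Cod C f)) (\<tau> (Cod C f))) (FM F f)"
      unfolding nat_trans_square[OF \<tau> f] using f by (simp add: D.Comp_Comp)
    finally show ?thesis .
  qed
  then show ?thesis using F H by (simp add: nat_trans_def hom_iff)
qed

lemma nat_trans_Ident:
  assumes C: "category C" and D: "category D" and F: "is_functor C D F"
  shows "nat_trans C D F F (\<lambda>x \<in> Obj C. Ident D (FO F x))"
proof -
  interpret C: category C by (rule C)
  interpret D: category D by (rule D)
  show ?thesis using F
    by (simp add: nat_trans_def hom_iff C.Dom_in C.Cod_in functor_simps[OF F])
qed

lemma functors_on_simps:
  "Obj (functors_on S C D) = S"
  "(F, \<tau>, G) \<in> Arr (functors_on S C D) \<longleftrightarrow> F \<in> S \<and> G \<in> S \<and> nat_trans C D F G \<tau>"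
  "Dom (functors_on S C D) (F, \<tau>, G) = F"
  "Cod (functors_on S C D) (F, \<tau>, G) = G"
  "Ident (functors_on S C D) F = (F, \<lambda>x \<in> Obj C. Ident D (FO F x), F)"
  "Comp (functors_on S C D) (G', \<sigma>, H) (F, \<tau>, G) = (F, \<lambda>x \<in> Obj C. Comp D (\<sigma> x) (\<tau> x), H)"
  "(F, \<tau>, G) \<in> Weq (functors_on S C D) \<longleftrightarrow>
    (F, \<tau>, G) \<in> Arr (functors_on S C D) \<and> (\<forall>x \<in> Obj C. \<tau> x \<in> Weq D)"
  by (auto simp: functors_on_def)

lemma Weq_functors_on: "Weq (functors_on S C D) \<subseteq> Arr (functors_on S C D)"
  by (auto simp: functors_on_def)

lemma category_functors_on:
  assumes C: "category C" and D: "category D" and S: "\<And>F. F \<in> S \<Longrightarrow> is_functor C D F"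
  shows "category (functors_on S C D)" (is "category ?K")
proof -
  interpret C: category C by (rule C)
  interpret D: category D by (rule D)
  have homD: "nat_trans C D F G \<tau> \<Longrightarrow> x \<in> Obj C \<Longrightarrow>
      \<tau> x \<in> Arr D \<and> Dom D (\<tau> x) = FO F x \<and> Cod D (\<tau> x) = FO G x" for F G \<tau> x
    using nat_trans_hom[of C D F G \<tau> x] by (simp add: hom_iff)
  have arrE: "\<exists>F \<tau> G. t = (F, \<tau>, G) \<and> F \<in> S \<and> G \<in> S \<and> nat_trans C D F G \<tau>" if "t \<in> Arr ?K" for t
    using that by (auto simp: functors_on_def)
  have homE: "\<exists>\<tau>. t = (F, \<tau>, G) \<and> F \<in> S \<and> G \<in> S \<and> nat_trans C D F G \<tau>" if "t \<in> hom ?K F G" for t F G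
    using that by (auto simp: functors_on_def hom_iff)
  note [simp] = functors_on_simps hom_iff
  show ?thesis
  proof
    fix t F G H K s u
    show "t \<in> Arr ?K \<Longrightarrow> Dom ?K t \<in> Obj ?K" "t \<in> Arr ?K \<Longrightarrow> Cod ?K t \<in> Obj ?K"
      by (auto dest: arrE)
    show "F \<in> Obj ?K \<Longrightarrow> Ident ?K F \<in> hom ?K F F"
      by (simp add: nat_trans_Ident[OF C D S])
    show "t \<in> hom ?K F G \<Longrightarrow> s \<in> hom ?K G H \<Longrightarrow> Comp ?K s t \<in> hom ?K F H"
      by (drule homE, drule homE) (auto intro: nat_trans_comp[OF C D])
    show "Comp ?K t (Ident ?K F) = t" "Comp ?K (Ident ?K G) t = t" if t: "t \<in> hom ?K F G"
    proof -
      obtain \<tau> where \<tau>: "t = (F, \<tau>, G)" "nat_trans C D F G \<tau>" using homE[OF t] by blast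
      show "Comp ?K t (Ident ?K F) = t" "Comp ?K (Ident ?K G) t = t"
        using \<tau> nat_trans_ext[OF \<tau>(2)] homD[OF \<tau>(2)]
        by (auto simp: extensional_def intro!: ext)
    qed
    assume t: "t \<in> hom ?K F G" and s: "s \<in> hom ?K G H" and u: "u \<in> hom ?K H K"
    obtain \<tau> \<sigma> \<upsilon> where
      e: "t = (F, \<tau>, G)" "nat_trans C D F G \<tau>" "s = (G, \<sigma>, H)" "nat_trans C D G H \<sigma>"
        "u = (H, \<upsilon>, K)" "nat_trans C D H K \<upsilon>"
      using homE[OF t] homE[OF s] homE[OF u] by blast
    show "Comp ?K u (Comp ?K s t) = Comp ?K (Comp ?K u s) t"
    proof -
      have "Comp D (\<upsilon> x) (Comp D (\<sigma> x) (\<tau> x)) = Comp D (Comp D (\<upsilon> x) (\<sigma> x)) (\<tau> x)"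
        if x: "x \<in> Obj C" for x
        using homD[OF e(2) x] homD[OF e(4) x] homD[OF e(6) x] by (simp add: D.Comp_Comp)
      then show ?thesis
        unfolding e(1,3,5) by (simp cong: restrict_cong)
    qed
  qed
qed

lemma Obj_relfun: "F \<in> Obj (relfun C D) \<longleftrightarrow> relative_functor C D F"
  by (simp add: relfun_def functors_on_simps)

lemma category_relfun: "category C \<Longrightarrow> category D \<Longrightarrow> category (relfun C D)"
  unfolding relfun_def by (rule category_functors_on) (auto simp: relative_functor_def)

lemma Weq_relfun: "Weq (relfun C D) \<subseteq> Arr (relfun C D)"
  unfolding relfun_def by (rule Weq_functors_on)

lemma Arr_relfunE:
  assumes "t \<in> Arr (relfun C D)"
  obtains F \<tau> G where "t = (F, \<tau>, G)" "relative_functor C D F" "relative_functor C D G"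
    "nat_trans C D F G \<tau>"
  using assms by (auto simp: relfun_def functors_on_def)

lemma relfun_simps:
  "(F, \<tau>, G) \<in> Arr (relfun C D) \<longleftrightarrow>
    relative_functor C D F \<and> relative_functor C D G \<and> nat_trans C D F G \<tau>"
  "Dom (relfun C D) (F, \<tau>, G) = F"
  "Cod (relfun C D) (F, \<tau>, G) = G"
  "Ident (relfun C D) F = (F, \<lambda>x \<in> Obj C. Ident D (FO F x), F)"
  "Comp (relfun C D) (G', \<sigma>, H) (F, \<tau>, G) = (F, \<lambda>x \<in> Obj C. Comp D (\<sigma> x) (\<tau> x), H)"
  "(F, \<tau>, G) \<in> Weq (relfun C D) \<longleftrightarrow>
    (F, \<tau>, G) \<in> Arr (relfun C D) \<and> (\<forall>x \<in> Obj C. \<tau> x \<in> Weq D)"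
  unfolding relfun_def by (simp_all add: functors_on_simps)

lemma relative_functor_comp:
  assumes C: "category C" and W: "Weq C \<subseteq> Arr C"
    and F: "relative_functor C D F" and G: "relative_functor D E G"
  shows "relative_functor C E (comp_functor C G F)"
  unfolding relative_functor_def
proof
  show "is_functor C E (comp_functor C G F)"
    by (rule is_functor_comp[OF C relative_functor_functor[OF F] relative_functor_functor[OF G]])
  show "\<forall>w \<in> Weq C. FM (comp_functor C G F) w \<in> Weq E"
  proof
    fix w assume "w \<in> Weq C"
    then show "FM (comp_functor C G F) w \<in> Weq E"
      using W F G by (simp add: subsetD comp_functor_def relative_functor_def)
  qed
qed

lemma relative_functor_eval:
  assumes C: "category C" and D: "category D" and x: "x \<in> Obj C"
  shows "relative_functor (relfun C D) D (eval_functor C D x)"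
  unfolding relative_functor_def
proof
  interpret R: category "relfun C D" by (rule category_relfun[OF C D])
  note [simp] = relfun_simps hom_iff nt_map_def Obj_relfun
  have FM_ev: "FM (eval_functor C D x) (F, \<tau>, G) = \<tau> x" if "(F, \<tau>, G) \<in> Arr (relfun C D)" for F \<tau> G
    using that by (simp add: eval_functor_def)
  have FO_ev: "FO (eval_functor C D x) F = FO F x" if "relative_functor C D F" for F
    using that by (simp add: eval_functor_def)
  show "is_functor (relfun C D) D (eval_functor C D x)"
  proof (rule is_functorI)
    show "FO (eval_functor C D x) \<in> extensional (Obj (relfun C D))"
      "FM (eval_functor C D x) \<in> extensional (Arr (relfun C D))"
      by (auto simp: eval_functor_def)
    show "F \<in> Obj (relfun C D) \<Longrightarrow> FO (eval_functor C D x) F \<in> Obj D" for F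
      using x functor_Obj by (fastforce simp: FO_ev relative_functor_def)
    show "FM (eval_functor C D x) t \<in> hom D (FO (eval_functor C D x) (Dom (relfun C D) t))
        (FO (eval_functor C D x) (Cod (relfun C D) t))" if t: "t \<in> Arr (relfun C D)" for t
    proof -
      obtain F \<tau> G where e: "t = (F, \<tau>, G)" "relative_functor C D F" "relative_functor C D G"
          "nat_trans C D F G \<tau>"
        using t by (rule Arr_relfunE)
      then show ?thesis using nat_trans_hom[OF e(4) x] t by (simp add: FM_ev FO_ev)
    qed
    show "F \<in> Obj (relfun C D) \<Longrightarrow>
        FM (eval_functor C D x) (Ident (relfun C D) F) = Ident D (FO (eval_functor C D x) F)" for F
      using x R.Arr_Ident[of F] by (simp add: FM_ev FO_ev)
    fix s t assume st: "s \<in> Arr (relfun C D)" "t \<in> Arr (relfun C D)"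
      "Cod (relfun C D) s = Dom (relfun C D) t"
    obtain F \<tau> G G' \<sigma> H where "s = (F, \<tau>, G)" "t = (G', \<sigma>, H)"
      using prod_cases3 by metis
    then show "FM (eval_functor C D x) (Comp (relfun C D) t s) =
        Comp D (FM (eval_functor C D x) t) (FM (eval_functor C D x) s)"
      using x st R.Arr_Comp[OF st] by (simp add: FM_ev)
  qed
  show "\<forall>t \<in> Weq (relfun C D). FM (eval_functor C D x) t \<in> Weq D"
  proof
    fix t assume t: "t \<in> Weq (relfun C D)"
    obtain F \<tau> G where "t = (F, \<tau>, G)" using prod_cases3 by metis
    then show "FM (eval_functor C D x) t \<in> Weq D"
      using t x by (simp add: FM_ev)
  qed
qed

lemma nat_trans_postcomp:
  assumes C: "category C" and \<tau>: "nat_trans C D F G \<tau>" and K: "is_functor D E K"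
  shows "nat_trans C E (comp_functor C K F) (comp_functor C K G) (\<lambda>x \<in> Obj C. FM K (\<tau> x))"
proof -
  interpret C: category C by (rule C)
  note FG = nat_trans_functors[OF \<tau>]
  note [simp] = C.Dom_in C.Cod_in functor_simps[OF FG(1)] functor_simps[OF FG(2)] functor_simps[OF K]
    nat_trans_hom[OF \<tau>, unfolded hom_iff]
  have "Comp E (FM K (FM G f)) (FM K (\<tau> (Dom C f))) = Comp E (FM K (\<tau> (Cod C f))) (FM K (FM F f))"
    if f: "f \<in> Arr C" for f
    using f arg_cong[OF nat_trans_square[OF \<tau> f], of "FM K"] by (simp add: functor_Comp[OF K])
  then show ?thesis
    using is_functor_comp[OF C FG(1) K] is_functor_comp[OF C FG(2) K]
    by (simp add: nat_trans_def hom_iff) (simp add: comp_functor_def)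
qed

lemma nat_trans_precomp:
  assumes B: "category B" and \<tau>: "nat_trans C D F G \<tau>" and J: "is_functor B C J"
  shows "nat_trans B D (comp_functor B F J) (comp_functor B G J) (\<lambda>x \<in> Obj B. \<tau> (FO J x))"
proof -
  interpret B: category B by (rule B)
  note FG = nat_trans_functors[OF \<tau>]
  note [simp] = B.Dom_in B.Cod_in functor_simps[OF FG(1)] functor_simps[OF FG(2)] functor_simps[OF J]
    nat_trans_hom[OF \<tau>, unfolded hom_iff]
  have "Comp D (FM G (FM J f)) (\<tau> (FO J (Dom B f))) = Comp D (\<tau> (FO J (Cod B f))) (FM F (FM J f))"
    if f: "f \<in> Arr B" for f
    using f nat_trans_square[OF \<tau>, of "FM J f"] by simp
  then show ?thesis
    using is_functor_comp[OF B J FG(1)] is_functor_comp[OF B J FG(2)]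
    by (simp add: nat_trans_def hom_iff) (simp add: comp_functor_def)
qed

lemma relative_functor_postcomp:
  assumes C: "category C" and D: "category D" and E: "category E" and W: "Weq C \<subseteq> Arr C"
    and K: "relative_functor D E K"
  shows "relative_functor (relfun C D) (relfun C E) (postcomp C D K)"
  unfolding relative_functor_def
proof
  interpret R: category "relfun C D" by (rule category_relfun[OF C D])
  note K' = relative_functor_functor[OF K]
  note [simp] = relfun_simps hom_iff Obj_relfun relative_functor_comp[OF C W _ K]
    nat_trans_postcomp[OF C _ K']
  have FM_post: "FM (postcomp C D K) (F, \<tau>, G) =
      (comp_functor C K F, \<lambda>x \<in> Obj C. FM K (\<tau> x), comp_functor C K G)"
    if "(F, \<tau>, G) \<in> Arr (relfun C D)" for F \<tau> G
    using that by (simp add: postcomp_def)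
  have FO_post: "FO (postcomp C D K) F = comp_functor C K F" if "relative_functor C D F" for F
    using that by (simp add: postcomp_def)
  show "is_functor (relfun C D) (relfun C E) (postcomp C D K)"
  proof (rule is_functorI)
    show "FO (postcomp C D K) \<in> extensional (Obj (relfun C D))"
      "FM (postcomp C D K) \<in> extensional (Arr (relfun C D))"
      by (auto simp: postcomp_def)
    show "F \<in> Obj (relfun C D) \<Longrightarrow> FO (postcomp C D K) F \<in> Obj (relfun C E)" for F
      by (simp add: FO_post)
    show "FM (postcomp C D K) t \<in> hom (relfun C E) (FO (postcomp C D K) (Dom (relfun C D) t))
        (FO (postcomp C D K) (Cod (relfun C D) t))" if t: "t \<in> Arr (relfun C D)" for t
      using t by (elim Arr_relfunE) (simp add: FM_post FO_post)
    show "FM (postcomp C D K) (Ident (relfun C D) F) = Ident (relfun C E) (FO (postcomp C D K) F)"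
      if F: "F \<in> Obj (relfun C D)" for F
    proof -
      have F': "is_functor C D F" using F by (simp add: relative_functor_def)
      show ?thesis using F R.Arr_Ident[OF F]
        by (simp add: FM_post FO_post)
          (auto simp: comp_functor_def functor_Obj[OF F'] functor_Ident[OF K'])
    qed
    fix s t assume st: "s \<in> Arr (relfun C D)" "t \<in> Arr (relfun C D)"
      "Cod (relfun C D) s = Dom (relfun C D) t"
    obtain F \<tau> G where s: "s = (F, \<tau>, G)" "nat_trans C D F G \<tau>"
      using st(1) by (rule Arr_relfunE)
    obtain G' \<sigma> H where t: "t = (G', \<sigma>, H)" "nat_trans C D G' H \<sigma>"
      using st(2) by (rule Arr_relfunE)
    have "G' = G" using s t st by simp
    then have "FM K (Comp D (\<sigma> x) (\<tau> x)) = Comp E (FM K (\<sigma> x)) (FM K (\<tau> x))" if "x \<in> Obj C" for x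
      using nat_trans_hom[OF s(2) that] nat_trans_hom[OF t(2) that]
      by (simp add: functor_Comp[OF K'])
    then show "FM (postcomp C D K) (Comp (relfun C D) t s) =
        Comp (relfun C E) (FM (postcomp C D K) t) (FM (postcomp C D K) s)"
      using s t st R.Arr_Comp[OF st] by (auto simp: FM_post)
  qed
  show "\<forall>t \<in> Weq (relfun C D). FM (postcomp C D K) t \<in> Weq (relfun C E)"
  proof
    fix t assume t: "t \<in> Weq (relfun C D)"
    obtain F \<tau> G where "t = (F, \<tau>, G)" using prod_cases3 by metis
    then show "FM (postcomp C D K) t \<in> Weq (relfun C E)"
      using t K by (simp add: FM_post) (simp add: relative_functor_def)
  qed
qed

lemma relative_functor_precomp:
  assumes B: "category B" and C: "category C" and D: "category D" and W: "Weq B \<subseteq> Arr B"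
    and J: "relative_functor B C J"
  shows "relative_functor (relfun C D) (relfun B D) (precomp B C D J)"
  unfolding relative_functor_def
proof
  interpret R: category "relfun C D" by (rule category_relfun[OF C D])
  note J' = relative_functor_functor[OF J]
  note [simp] = relfun_simps hom_iff Obj_relfun relative_functor_comp[OF B W J]
    nat_trans_precomp[OF B _ J'] functor_Obj[OF J']
  have FM_pre: "FM (precomp B C D J) (F, \<tau>, G) =
      (comp_functor B F J, \<lambda>x \<in> Obj B. \<tau> (FO J x), comp_functor B G J)"
    if "(F, \<tau>, G) \<in> Arr (relfun C D)" for F \<tau> G
    using that by (simp add: precomp_def)
  have FO_pre: "FO (precomp B C D J) F = comp_functor B F J" if "relative_functor C D F" for F
    using that by (simp add: precomp_def)
  show "is_functor (relfun C D) (relfun B D) (precomp B C D J)"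
  proof (rule is_functorI)
    show "FO (precomp B C D J) \<in> extensional (Obj (relfun C D))"
      "FM (precomp B C D J) \<in> extensional (Arr (relfun C D))"
      by (auto simp: precomp_def)
    show "F \<in> Obj (relfun C D) \<Longrightarrow> FO (precomp B C D J) F \<in> Obj (relfun B D)" for F
      by (simp add: FO_pre)
    show "FM (precomp B C D J) t \<in> hom (relfun B D) (FO (precomp B C D J) (Dom (relfun C D) t))
        (FO (precomp B C D J) (Cod (relfun C D) t))" if t: "t \<in> Arr (relfun C D)" for t
      using t by (elim Arr_relfunE) (simp add: FM_pre FO_pre)
    show "FM (precomp B C D J) (Ident (relfun C D) F) = Ident (relfun B D) (FO (precomp B C D J) F)"
      if F: "F \<in> Obj (relfun C D)" for F
      using F R.Arr_Ident[OF F] by (simp add: FM_pre FO_pre) (auto simp: comp_functor_def)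
    fix s t assume st: "s \<in> Arr (relfun C D)" "t \<in> Arr (relfun C D)"
      "Cod (relfun C D) s = Dom (relfun C D) t"
    obtain F \<tau> G G' \<sigma> H where "s = (F, \<tau>, G)" "t = (G', \<sigma>, H)"
      using prod_cases3 by metis
    then show "FM (precomp B C D J) (Comp (relfun C D) t s) =
        Comp (relfun B D) (FM (precomp B C D J) t) (FM (precomp B C D J) s)"
      using st R.Arr_Comp[OF st] by (auto simp: FM_pre)
  qed
  show "\<forall>t \<in> Weq (relfun C D). FM (precomp B C D J) t \<in> Weq (relfun B D)"
  proof
    fix t assume t: "t \<in> Weq (relfun C D)"
    obtain F \<tau> G where "t = (F, \<tau>, G)" using prod_cases3 by metis
    then show "FM (precomp B C D J) t \<in> Weq (relfun B D)"
      using t by (simp add: FM_pre)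
  qed
qed

lemma FO_eval: "relative_functor C D F \<Longrightarrow> FO (eval_functor C D x) F = FO F x"
  by (simp add: eval_functor_def Obj_relfun)

text \<open>Taking components at \<open>x\<close> is the functor induced on localizations by evaluation at \<open>x\<close>.\<close>

lemma rel_component_functor:
  assumes C: "category C" and D: "category D" and x: "x \<in> Obj C"
  shows rel_component_hom: "t \<in> hom (loc (relfun C D)) F G \<Longrightarrow>
      rel_component C D t x \<in> hom (loc D) (FO F x) (FO G x)"
    and rel_component_Ident: "relative_functor C D F \<Longrightarrow>
      rel_component C D (Ident (loc (relfun C D)) F) x = Ident (loc D) (FO F x)"
    and rel_component_Comp: "s \<in> hom (loc (relfun C D)) F G \<Longrightarrow> t \<in> hom (loc (relfun C D)) G H \<Longrightarrow>
      rel_component C D (Comp (loc (relfun C D)) t s) x =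
      Comp (loc D) (rel_component C D t x) (rel_component C D s x)"
proof -
  interpret L: category "loc (relfun C D)" by (rule category_loc[OF category_relfun[OF C D]])
  note ev = is_functor_loc[OF category_relfun[OF C D] D relative_functor_eval[OF C D x]]
  have FO: "FO (loc_functor (relfun C D) D (eval_functor C D x)) F = FO F x"
    if "relative_functor C D F" for F
    using that by (simp add: FO_loc_functor FO_eval Obj_relfun)
  show "t \<in> hom (loc (relfun C D)) F G \<Longrightarrow>
      rel_component C D t x \<in> hom (loc D) (FO F x) (FO G x)"
    using functor_hom[OF ev, of t F G] FO L.hom_Obj[of t F G]
    by (simp add: rel_component_def Obj_relfun)
  show "relative_functor C D F \<Longrightarrow>
      rel_component C D (Ident (loc (relfun C D)) F) x = Ident (loc D) (FO F x)"
    using functor_Ident[OF ev, of F] FO by (simp add: rel_component_def Obj_relfun)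
  show "s \<in> hom (loc (relfun C D)) F G \<Longrightarrow> t \<in> hom (loc (relfun C D)) G H \<Longrightarrow>
      rel_component C D (Comp (loc (relfun C D)) t s) x =
      Comp (loc D) (rel_component C D t x) (rel_component C D s x)"
    using functor_Comp[OF ev, of s t] by (simp add: rel_component_def hom_iff)
qed

text \<open>For a fixed arrow \<open>f : x \<rightarrow> y\<close> of \<open>C\<close>, the arrows \<open>\<gamma> (F f)\<close> are natural in the relative
  functor \<open>F\<close>, as a transformation between the evaluations at \<open>x\<close> and at \<open>y\<close>. Naturality in \<open>F\<close>
  extends to the localization of \<open>relfun C D\<close>, and read the other way round it is
  naturality in \<open>f\<close> of a given relative natural transformation.\<close>

lemma rel_component_square:
  assumes C: "category C" and D: "category D" and t: "t \<in> hom (loc (relfun C D)) F G"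
    and f: "f \<in> Arr C"
  shows "Comp (loc D) (FM (loc_gamma D) (FM G f)) (rel_component C D t (Dom C f)) =
    Comp (loc D) (rel_component C D t (Cod C f)) (FM (loc_gamma D) (FM F f))"
proof -
  interpret C: category C by (rule C)
  interpret L: category "loc (relfun C D)" by (rule category_loc[OF category_relfun[OF C D]])
  note g = is_functor_gamma[OF D]
  note xy = C.Dom_in[OF f] C.Cod_in[OF f]
  note ev = relative_functor_eval[OF C D]
  let ?\<tau> = "\<lambda>F \<in> Obj (relfun C D). FM (loc_gamma D) (FM F f)"
  have "nat_trans (loc (relfun C D)) (loc D)
      (loc_functor (relfun C D) D (eval_functor C D (Dom C f)))
      (loc_functor (relfun C D) D (eval_functor C D (Cod C f))) ?\<tau>"
  proof (rule nat_trans_on_loc[OF category_relfun[OF C D] category_loc[OF D]])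
    show "?\<tau> F \<in> hom (loc D) (FO (loc_functor (relfun C D) D (eval_functor C D (Dom C f))) F)
        (FO (loc_functor (relfun C D) D (eval_functor C D (Cod C f))) F)"
      if F: "F \<in> Obj (relfun C D)" for F
    proof -
      have "is_functor C D F" using F by (simp add: Obj_relfun relative_functor_def)
      then show ?thesis
        using F f xy
        by (simp add: hom_iff FO_loc_functor FO_eval Obj_relfun functor_simps functor_Arr[OF g]
            functor_Dom[OF g] functor_Cod[OF g] FO_gamma)
    qed
    fix s assume s: "s \<in> Arr (relfun C D)"
    obtain F \<tau> G where e: "s = (F, \<tau>, G)" "relative_functor C D F" "relative_functor C D G"
        "nat_trans C D F G \<tau>"
      using s by (rule Arr_relfunE)
    note FG = nat_trans_functors[OF e(4)]
    have "FM (eval_functor C D x) s = \<tau> x" for x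
      using s by (simp add: e(1) eval_functor_def nt_map_def)
    then show "Comp (loc D) (FM (loc_functor (relfun C D) D (eval_functor C D (Cod C f)))
          (FM (loc_gamma (relfun C D)) s)) (?\<tau> (Dom (relfun C D) s)) =
        Comp (loc D) (?\<tau> (Cod (relfun C D) s))
          (FM (loc_functor (relfun C D) D (eval_functor C D (Dom C f)))
            (FM (loc_gamma (relfun C D)) s))"
      using e f nat_trans_square[OF e(4) f] nat_trans_hom[OF e(4) xy(1)] nat_trans_hom[OF e(4) xy(2)]
      by (simp add: loc_functor_gamma[OF category_relfun[OF C D] ev _ ] s xy relfun_simps Obj_relfun
          functor_Comp[OF g, symmetric] functor_simps[OF FG(1)] functor_simps[OF FG(2)] hom_iff)
  qed (auto intro: is_functor_loc[OF category_relfun[OF C D] D] ev xy)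
  from nat_trans_square[OF this, of t] t show ?thesis
    using L.Dom_in[of t] L.Cod_in[of t] by (simp add: hom_iff rel_component_def)
qed

lemma whisker_post_hom:
  assumes C: "category C" and D: "category D" and E: "category E" and W: "Weq C \<subseteq> Arr C"
    and K: "relative_functor D E K" and t: "t \<in> hom (loc (relfun C D)) F G"
  shows "whisker_post C D E K t \<in>
    hom (loc (relfun C E)) (comp_functor C K F) (comp_functor C K G)"
proof -
  interpret L: category "loc (relfun C D)" by (rule category_loc[OF category_relfun[OF C D]])
  show ?thesis
    using functor_hom[OF is_functor_loc[OF category_relfun[OF C D] category_relfun[OF C E]
          relative_functor_postcomp[OF C D E W K]] t] L.hom_Obj[OF t]
    by (simp add: whisker_post_def FO_loc_functor postcomp_def)
qed

lemma whisker_pre_hom: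
  assumes B: "category B" and C: "category C" and D: "category D" and W: "Weq B \<subseteq> Arr B"
    and J: "relative_functor B C J" and t: "t \<in> hom (loc (relfun C D)) F G"
  shows "whisker_pre B C D J t \<in>
    hom (loc (relfun B D)) (comp_functor B F J) (comp_functor B G J)"
proof -
  interpret L: category "loc (relfun C D)" by (rule category_loc[OF category_relfun[OF C D]])
  show ?thesis
    using functor_hom[OF is_functor_loc[OF category_relfun[OF C D] category_relfun[OF B D]
          relative_functor_precomp[OF B C D W J]] t] L.hom_Obj[OF t]
    by (simp add: whisker_pre_def FO_loc_functor precomp_def)
qed

text \<open>Components of whiskered transformations. Evaluation at \<open>x\<close> after composition with \<open>K\<close>
  is \<open>K\<close> after evaluation at \<open>x\<close>, and evaluation at \<open>x\<close> after restriction along \<open>J\<close> is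
  evaluation at \<open>J x\<close>. These are equalities of functors on \<open>relfun C D\<close>, so they persist on
  the localizations.\<close>

lemma rel_component_whisker_post:
  assumes C: "category C" and D: "category D" and E: "category E" and W: "Weq C \<subseteq> Arr C"
    and K: "relative_functor D E K" and t: "t \<in> hom (loc (relfun C D)) F G"
    and x: "x \<in> Obj C"
  shows "rel_component C E (whisker_post C D E K t) x =
    FM (loc_functor D E K) (rel_component C D t x)"
proof -
  note R = category_relfun[OF C]
  note post = relative_functor_postcomp[OF C D E W K]
  have "comp_functor (relfun C D) (eval_functor C E x) (postcomp C D K) =
      comp_functor (relfun C D) K (eval_functor C D x)"
  proof (rule func_eqI)
    note [simp] = comp_functor_def postcomp_def eval_functor_def nt_map_def Obj_relfun x
    have "relative_functor C D F \<Longrightarrow> relative_functor C E (comp_functor C K F)" for F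
      using relative_functor_comp[OF C W _ K] .
    then show "FO (comp_functor (relfun C D) (eval_functor C E x) (postcomp C D K)) =
        FO (comp_functor (relfun C D) K (eval_functor C D x))"
      by (intro ext) simp
    have "FM (postcomp C D K) t \<in> Arr (relfun C E)" if "t \<in> Arr (relfun C D)" for t
      using functor_Arr[OF relative_functor_functor[OF post] that] .
    then show "FM (comp_functor (relfun C D) (eval_functor C E x) (postcomp C D K)) =
        FM (comp_functor (relfun C D) K (eval_functor C D x))"
      by (intro ext) (auto split: prod.splits)
  qed
  with t show ?thesis
    unfolding rel_component_def whisker_post_def hom_iff
    by (simp add: loc_functor_comp[OF R[OF D] R[OF E] post relative_functor_eval[OF C E x]]
        loc_functor_comp[OF R[OF D] D relative_functor_eval[OF C D x] K] Weq_relfun)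
qed

lemma rel_component_whisker_pre:
  assumes B: "category B" and C: "category C" and D: "category D" and W: "Weq B \<subseteq> Arr B"
    and J: "relative_functor B C J" and t: "t \<in> hom (loc (relfun C D)) F G"
    and x: "x \<in> Obj B"
  shows "rel_component B D (whisker_pre B C D J t) x = rel_component C D t (FO J x)"
proof -
  note R = category_relfun[OF _ D]
  note pre = relative_functor_precomp[OF B C D W J]
  have "comp_functor (relfun C D) (eval_functor B D x) (precomp B C D J) =
      eval_functor C D (FO J x)"
  proof (rule func_eqI)
    note [simp] = comp_functor_def precomp_def eval_functor_def nt_map_def Obj_relfun x
    have "relative_functor C D F \<Longrightarrow> relative_functor B D (comp_functor B F J)" for F
      using relative_functor_comp[OF B W J] .
    then show "FO (comp_functor (relfun C D) (eval_functor B D x) (precomp B C D J)) =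
        FO (eval_functor C D (FO J x))"
      by (intro ext) simp
    have "FM (precomp B C D J) t \<in> Arr (relfun B D)" if "t \<in> Arr (relfun C D)" for t
      using functor_Arr[OF relative_functor_functor[OF pre] that] .
    then show "FM (comp_functor (relfun C D) (eval_functor B D x) (precomp B C D J)) =
        FM (eval_functor C D (FO J x))"
      by (intro ext) (auto split: prod.splits)
  qed
  with t show ?thesis
    unfolding rel_component_def whisker_pre_def hom_iff
    by (simp add: loc_functor_comp[OF R[OF C] R[OF B] pre relative_functor_eval[OF B D x]] Weq_relfun)
qed

section \<open>Adjunctions\<close>

definition adjunction ::
  "('o, 'm, 'r) cat_scheme \<Rightarrow> ('p, 'n, 's) cat_scheme
     \<Rightarrow> ('o, 'm, 'p, 'n) func \<Rightarrow> ('p, 'n, 'o, 'm) func \<Rightarrow> ('o \<Rightarrow> 'm) \<Rightarrow> ('p \<Rightarrow> 'n) \<Rightarrow> bool" where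
  "adjunction C D F G \<eta> \<epsilon> \<longleftrightarrow>
     is_functor C D F \<and> is_functor D C G \<and>
     nat_trans C C (id_functor C) (comp_functor C G F) \<eta> \<and>
     nat_trans D D (comp_functor D F G) (id_functor D) \<epsilon> \<and>
     (\<forall>x \<in> Obj C. Comp D (\<epsilon> (FO F x)) (FM F (\<eta> x)) = Ident D (FO F x)) \<and>
     (\<forall>y \<in> Obj D. Comp C (FM G (\<epsilon> y)) (\<eta> (FO G y)) = Ident C (FO G y))"

lemma adjunctionD:
  assumes A: "adjunction C D F G \<eta> \<epsilon>"
  shows "x \<in> Obj C \<Longrightarrow> \<eta> x \<in> hom C x (FO G (FO F x))"
    and "y \<in> Obj D \<Longrightarrow> \<epsilon> y \<in> hom D (FO F (FO G y)) y"
    and "f \<in> hom C x x' \<Longrightarrow> Comp C (FM G (FM F f)) (\<eta> x) = Comp C (\<eta> x') f"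
    and "g \<in> hom D y y' \<Longrightarrow> Comp D g (\<epsilon> y) = Comp D (\<epsilon> y') (FM F (FM G g))"
    and "x \<in> Obj C \<Longrightarrow> Comp D (\<epsilon> (FO F x)) (FM F (\<eta> x)) = Ident D (FO F x)"
    and "y \<in> Obj D \<Longrightarrow> Comp C (FM G (\<epsilon> y)) (\<eta> (FO G y)) = Ident C (FO G y)"
proof -
  have n: "nat_trans C C (id_functor C) (comp_functor C G F) \<eta>"
    "nat_trans D D (comp_functor D F G) (id_functor D) \<epsilon>"
    using A by (auto simp: adjunction_def)
  show "x \<in> Obj C \<Longrightarrow> \<eta> x \<in> hom C x (FO G (FO F x))"
    using nat_trans_hom[OF n(1), of x] by (simp add: id_functor_def comp_functor_def)
  show "y \<in> Obj D \<Longrightarrow> \<epsilon> y \<in> hom D (FO F (FO G y)) y"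
    using nat_trans_hom[OF n(2), of y] by (simp add: id_functor_def comp_functor_def)
  show "f \<in> hom C x x' \<Longrightarrow> Comp C (FM G (FM F f)) (\<eta> x) = Comp C (\<eta> x') f"
    using nat_trans_square[OF n(1), of f] by (auto simp: id_functor_def comp_functor_def hom_iff)
  show "g \<in> hom D y y' \<Longrightarrow> Comp D g (\<epsilon> y) = Comp D (\<epsilon> y') (FM F (FM G g))"
    using nat_trans_square[OF n(2), of g] by (auto simp: id_functor_def comp_functor_def hom_iff)
qed (use A in \<open>auto simp: adjunction_def\<close>)

text \<open>The unit and the counit of a relative adjunction become natural transformations between
  functors on the localizations by taking components, and the triangle identities, which hold
  in localized functor categories, can be read off component by component. They make sense
  because the two bracketings of \<open>F G F\<close> are equal as functors, as are those of \<open>G F G\<close>.\<close>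

theorem adjunction_loc:
  assumes C: "category C" and D: "category D"
    and WC: "Weq C \<subseteq> Arr C" and WD: "Weq D \<subseteq> Arr D"
    and adj: "relative_adjunction C D F G \<alpha> \<beta>"
  shows "adjunction (loc C) (loc D) (loc_functor C D F) (loc_functor D C G)
    (\<lambda>x \<in> Obj C. rel_component C C \<beta> x) (\<lambda>y \<in> Obj D. rel_component D D \<alpha> y)"
proof -
  interpret C: category C by (rule C)
  interpret D: category D by (rule D)
  let ?LF = "loc_functor C D F" and ?LG = "loc_functor D C G"
  have F: "relative_functor C D F" and G: "relative_functor D C G"
    and \<alpha>: "\<alpha> \<in> hom (loc (relfun D D)) (comp_functor D F G) (id_functor D)"
    and \<beta>: "\<beta> \<in> hom (loc (relfun C C)) (id_functor C) (comp_functor C G F)"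
    and tF: "Comp (loc (relfun C D)) (whisker_pre C D D F \<alpha>) (whisker_post C C D F \<beta>) =
      Ident (loc (relfun C D)) F"
    and tG: "Comp (loc (relfun D C)) (whisker_post D D C G \<alpha>) (whisker_pre D C C G \<beta>) =
      Ident (loc (relfun D C)) G"
    using adj by (auto simp: relative_adjunction_def)
  note F' = relative_functor_functor[OF F] and G' = relative_functor_functor[OF G]
  note LF = is_functor_loc[OF C D F] and LG = is_functor_loc[OF D C G]
  note LC = category_loc[OF C] and LD = category_loc[OF D]
  note [simp] = functor_simps[OF F'] functor_simps[OF G'] FO_loc_functor C.Dom_in C.Cod_in
    D.Dom_in D.Cod_in functor_Arr[OF is_functor_gamma[OF C]] functor_Arr[OF is_functor_gamma[OF D]]
  have unit: "nat_trans (loc C) (loc C) (id_functor (loc C)) (comp_functor (loc C) ?LG ?LF)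
      (\<lambda>x \<in> Obj C. rel_component C C \<beta> x)"
  proof (rule nat_trans_on_loc[OF C LC is_functor_id[OF LC] is_functor_comp[OF LC LF LG]])
    show "x \<in> Obj C \<Longrightarrow> (\<lambda>x \<in> Obj C. rel_component C C \<beta> x) x
        \<in> hom (loc C) (FO (id_functor (loc C)) x) (FO (comp_functor (loc C) ?LG ?LF) x)" for x
      using rel_component_hom[OF C C _ \<beta>, of x] by (simp add: id_functor_def comp_functor_def)
    show "f \<in> Arr C \<Longrightarrow>
      Comp (loc C) (FM (comp_functor (loc C) ?LG ?LF) (FM (loc_gamma C) f))
        ((\<lambda>x \<in> Obj C. rel_component C C \<beta> x) (Dom C f)) =
      Comp (loc C) ((\<lambda>x \<in> Obj C. rel_component C C \<beta> x) (Cod C f))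
        (FM (id_functor (loc C)) (FM (loc_gamma C) f))" for f
      using rel_component_square[OF C C \<beta>, of f]
      by (simp add: id_functor_def comp_functor_def loc_functor_gamma[OF C F] loc_functor_gamma[OF D G])
  qed simp
  have counit: "nat_trans (loc D) (loc D) (comp_functor (loc D) ?LF ?LG) (id_functor (loc D))
      (\<lambda>y \<in> Obj D. rel_component D D \<alpha> y)"
  proof (rule nat_trans_on_loc[OF D LD is_functor_comp[OF LD LG LF] is_functor_id[OF LD]])
    show "x \<in> Obj D \<Longrightarrow> (\<lambda>x \<in> Obj D. rel_component D D \<alpha> x) x
        \<in> hom (loc D) (FO (comp_functor (loc D) ?LF ?LG) x) (FO (id_functor (loc D)) x)" for x
      using rel_component_hom[OF D D _ \<alpha>, of x] by (simp add: id_functor_def comp_functor_def)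
    show "f \<in> Arr D \<Longrightarrow>
      Comp (loc D) (FM (id_functor (loc D)) (FM (loc_gamma D) f))
        ((\<lambda>x \<in> Obj D. rel_component D D \<alpha> x) (Dom D f)) =
      Comp (loc D) ((\<lambda>x \<in> Obj D. rel_component D D \<alpha> x) (Cod D f))
        (FM (comp_functor (loc D) ?LF ?LG) (FM (loc_gamma D) f))" for f
      using rel_component_square[OF D D \<alpha>, of f]
      by (simp add: id_functor_def comp_functor_def loc_functor_gamma[OF C F] loc_functor_gamma[OF D G])
  qed simp
  have assoc: "comp_functor C F (comp_functor C G F) = comp_functor C (comp_functor D F G) F"
    "comp_functor D (comp_functor C G F) G = comp_functor D G (comp_functor D F G)"
    by (auto simp: comp_functor_def intro!: ext)
  have "Comp (loc D) (rel_component D D \<alpha> (FO F x)) (FM ?LF (rel_component C C \<beta> x)) =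
      Ident (loc D) (FO F x)" if x: "x \<in> Obj C" for x
    using arg_cong[OF tF, of "\<lambda>t. rel_component C D t x"] x
      rel_component_Comp[OF C D x whisker_post_hom[OF C C D WC F \<beta>, unfolded assoc]
        whisker_pre_hom[OF C D D WC F \<alpha>]]
    by (simp add: rel_component_whisker_pre[OF C D D WC F \<alpha>] rel_component_Ident[OF C D x F]
        rel_component_whisker_post[OF C C D WC F \<beta>])
  moreover have "Comp (loc C) (FM ?LG (rel_component D D \<alpha> y)) (rel_component C C \<beta> (FO G y)) =
      Ident (loc C) (FO G y)" if y: "y \<in> Obj D" for y
    using arg_cong[OF tG, of "\<lambda>t. rel_component D C t y"] y
      rel_component_Comp[OF D C y whisker_pre_hom[OF D C C WD G \<beta>, unfolded assoc]
        whisker_post_hom[OF D D C WD G \<alpha>]]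
    by (simp add: rel_component_whisker_pre[OF D C C WD G \<beta>] rel_component_Ident[OF D C y G]
        rel_component_whisker_post[OF D D C WD G \<alpha>])
  ultimately show ?thesis
    using LF LG unit counit by (simp add: adjunction_def)
qed

section \<open>Left adjoints with a left adjoint on localizations\<close>

lemma functor_hom_Comp:
  "\<lbrakk>is_functor C D F; f \<in> hom C x y; g \<in> hom C y z\<rbrakk>
    \<Longrightarrow> Comp D (FM F g) (FM F f) = FM F (Comp C g f)"
  by (simp add: hom_iff functor_Comp)

lemma gamma_hom:
  assumes C: "category C" and f: "f \<in> hom C x y"
  shows "FM (loc_gamma C) f \<in> hom (loc C) x y"
  using functor_hom[OF is_functor_gamma[OF C] f] category.hom_Obj[OF C f] by (simp add: FO_gamma)

text \<open>The functor \<open>G\<close> preserves weak equivalences and has a left adjoint \<open>F\<close>, which need not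
  do so; but the functor induced by \<open>G\<close> on localizations has a left adjoint too, and this one is
  induced by the relative functor \<open>Q\<close>. For diagrams, \<open>F\<close> is the colimit, \<open>G\<close> the constant
  diagram functor and \<open>Q\<close> the homotopy colimit.\<close>

locale localized_adjunction =
  A: category A + B: category B
  for A :: "('a, 'k, 'r) relcat_scheme" and B :: "('b, 'n, 's) relcat_scheme" +
  fixes F Q :: "('a, 'k, 'b, 'n) func" and G :: "('b, 'n, 'a, 'k) func"
    and \<eta> :: "'a \<Rightarrow> 'k" and \<kappa> :: "'b \<Rightarrow> 'n"
    and \<beta> :: "'a \<Rightarrow> ('a, 'k) locarr" and \<alpha> :: "'b \<Rightarrow> ('b, 'n) locarr"
  assumes rel_G: "relative_functor B A G" and rel_Q: "relative_functor A B Q"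
    and adj: "adjunction A B F G \<eta> \<kappa>"
    and adj_loc: "adjunction (loc A) (loc B) (loc_functor A B Q) (loc_functor B A G) \<beta> \<alpha>"
begin

abbreviation "LQ \<equiv> loc_functor A B Q"
abbreviation "LG \<equiv> loc_functor B A G"
abbreviation "gA \<equiv> FM (loc_gamma A)"
abbreviation "gB \<equiv> FM (loc_gamma B)"

text \<open>The transpose \<open>Q a \<rightarrow> F a\<close> of the unit \<open>\<eta> a : a \<rightarrow> G (F a)\<close> under \<open>loc Q \<stileturn> loc G\<close>.\<close>

definition comparison :: "'a \<Rightarrow> ('b, 'n) locarr" where
  "comparison = (\<lambda>a \<in> Obj A. Comp (loc B) (\<alpha> (FO F a)) (gB (FM Q (\<eta> a))))"

sublocale LA: category "loc A"
  by (rule category_loc[OF A.category_axioms])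

sublocale LB: category "loc B"
  by (rule category_loc[OF B.category_axioms])

lemmas A_cat = A.category_axioms and B_cat = B.category_axioms

lemma F: "is_functor A B F" and G: "is_functor B A G" and Q: "is_functor A B Q"
  and LQ: "is_functor (loc A) (loc B) LQ" and LG: "is_functor (loc B) (loc A) LG"
  using adj adj_loc rel_Q by (simp_all add: adjunction_def relative_functor_def)

lemmas gA = gamma_hom[OF A_cat] and gB = gamma_hom[OF B_cat]

lemmas LQ_gA = loc_functor_gamma[OF A_cat rel_Q] and LG_gB = loc_functor_gamma[OF B_cat rel_G]

lemmas unit_hom = adjunctionD(1)[OF adj]
  and counit_hom = adjunctionD(2)[OF adj]
  and unit_square = adjunctionD(3)[OF adj]
  and counit_square = adjunctionD(4)[OF adj]
  and triangle_F = adjunctionD(5)[OF adj]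
  and triangle_G = adjunctionD(6)[OF adj]

lemmas adj_locD = adjunctionD[OF adj_loc, simplified]

lemma \<beta>_hom: "a \<in> Obj A \<Longrightarrow> \<beta> a \<in> hom (loc A) a (FO G (FO Q a))"
  using adj_locD(1)[of a] by (simp add: FO_loc_functor functor_Obj[OF Q])

lemma \<alpha>_hom: "x \<in> Obj B \<Longrightarrow> \<alpha> x \<in> hom (loc B) (FO Q (FO G x)) x"
  using adj_locD(2)[of x] by (simp add: FO_loc_functor functor_Obj[OF G])

lemma \<alpha>_square: "g \<in> hom B x y \<Longrightarrow>
    Comp (loc B) (gB g) (\<alpha> x) = Comp (loc B) (\<alpha> y) (FM LQ (gA (FM G g)))"
  using adj_locD(4)[OF gB, of g x y] by (simp add: LG_gB hom_iff)

lemma comparison_eq: "a \<in> Obj A \<Longrightarrow>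
    comparison a = Comp (loc B) (\<alpha> (FO F a)) (FM LQ (gA (\<eta> a)))"
  using unit_hom[of a] by (simp add: comparison_def LQ_gA hom_iff)

lemma LQ_hom: "t \<in> hom (loc A) a a' \<Longrightarrow> FM LQ t \<in> hom (loc B) (FO Q a) (FO Q a')"
  using functor_hom[OF LQ, of t a a'] LA.hom_Obj[of t a a'] by (simp add: FO_loc_functor)

lemma LG_hom: "t \<in> hom (loc B) x y \<Longrightarrow> FM LG t \<in> hom (loc A) (FO G x) (FO G y)"
  using functor_hom[OF LG, of t x y] LB.hom_Obj[of t x y] by (simp add: FO_loc_functor)

lemma comparison_hom:
  assumes a: "a \<in> Obj A"
  shows "comparison a \<in> hom (loc B) (FO Q a) (FO F a)"
  unfolding comparison_eq[OF a]
  by (rule LB.Comp_in[OF LQ_hom[OF gA[OF unit_hom[OF a]]] \<alpha>_hom[OF functor_Obj[OF F a]]])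

lemma comparison_square:
  assumes f: "f \<in> hom A a a'"
  shows "Comp (loc B) (gB (FM F f)) (comparison a) = Comp (loc B) (comparison a') (FM LQ (gA f))"
proof -
  note a = A.hom_Obj[OF f]
  note Ff = functor_hom[OF F f]
  note GFf = functor_hom[OF G Ff]
  note \<alpha> = \<alpha>_hom[OF functor_Obj[OF F a(1)]] \<alpha>_hom[OF functor_Obj[OF F a(2)]]
  note \<eta> = gA[OF unit_hom[OF a(1)]] gA[OF unit_hom[OF a(2)]]
  have "Comp (loc B) (gB (FM F f)) (comparison a) =
      Comp (loc B) (Comp (loc B) (gB (FM F f)) (\<alpha> (FO F a))) (FM LQ (gA (\<eta> a)))"
    unfolding comparison_eq[OF a(1)] by (rule LB.Comp_assoc[OF LQ_hom[OF \<eta>(1)] \<alpha>(1) gB[OF Ff]])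
  also have "\<dots> = Comp (loc B) (Comp (loc B) (\<alpha> (FO F a')) (FM LQ (gA (FM G (FM F f)))))
      (FM LQ (gA (\<eta> a)))"
    by (simp only: \<alpha>_square[OF Ff])
  also have "\<dots> = Comp (loc B) (\<alpha> (FO F a'))
      (Comp (loc B) (FM LQ (gA (FM G (FM F f)))) (FM LQ (gA (\<eta> a))))"
    by (rule LB.Comp_assoc[OF LQ_hom[OF \<eta>(1)] LQ_hom[OF gA[OF GFf]] \<alpha>(2), symmetric])
  also have "Comp (loc B) (FM LQ (gA (FM G (FM F f)))) (FM LQ (gA (\<eta> a))) =
      FM LQ (gA (Comp A (FM G (FM F f)) (\<eta> a)))"
    by (simp only: functor_hom_Comp[OF LQ \<eta>(1) gA[OF GFf]]
        functor_hom_Comp[OF is_functor_gamma[OF A_cat] unit_hom[OF a(1)] GFf])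
  also have "Comp A (FM G (FM F f)) (\<eta> a) = Comp A (\<eta> a') f"
    by (rule unit_square[OF f])
  also have "FM LQ (gA (Comp A (\<eta> a') f)) = Comp (loc B) (FM LQ (gA (\<eta> a'))) (FM LQ (gA f))"
    by (simp only: functor_hom_Comp[OF LQ gA[OF f] \<eta>(2)]
        functor_hom_Comp[OF is_functor_gamma[OF A_cat] f unit_hom[OF a(2)]])
  also have "Comp (loc B) (\<alpha> (FO F a')) \<dots> = Comp (loc B) (comparison a') (FM LQ (gA f))"
    unfolding comparison_eq[OF a(2)]
    by (rule LB.Comp_assoc[OF LQ_hom[OF gA[OF f]] LQ_hom[OF \<eta>(2)] \<alpha>(2)])
  finally show ?thesis .
qed

text \<open>The transpose of \<open>comparison a\<close> under \<open>loc Q \<stileturn> loc G\<close> is the image of the unit; this gives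
  existence of factorizations in the Kan extension property.\<close>

lemma transpose_comparison:
  assumes a: "a \<in> Obj A"
  shows "Comp (loc A) (FM LG (comparison a)) (\<beta> a) = gA (\<eta> a)"
proof -
  note \<alpha> = \<alpha>_hom[OF functor_Obj[OF F a]]
  note \<eta> = gA[OF unit_hom[OF a]]
  note Fa = functor_Obj[OF F a]
  note GFa = functor_Obj[OF G Fa]
  have "Comp (loc A) (FM LG (comparison a)) (\<beta> a) =
      Comp (loc A) (Comp (loc A) (FM LG (\<alpha> (FO F a))) (FM LG (FM LQ (gA (\<eta> a))))) (\<beta> a)"
    by (simp only: comparison_eq[OF a] functor_hom_Comp[OF LG LQ_hom[OF \<eta>] \<alpha>])
  also have "\<dots> = Comp (loc A) (FM LG (\<alpha> (FO F a))) (Comp (loc A) (FM LG (FM LQ (gA (\<eta> a)))) (\<beta> a))"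
    by (rule LA.Comp_assoc[OF \<beta>_hom[OF a] LG_hom[OF LQ_hom[OF \<eta>]] LG_hom[OF \<alpha>], symmetric])
  also have "\<dots> = Comp (loc A) (FM LG (\<alpha> (FO F a))) (Comp (loc A) (\<beta> (FO G (FO F a))) (gA (\<eta> a)))"
    by (simp only: adj_locD(3)[OF \<eta>])
  also have "\<dots> = Comp (loc A) (Comp (loc A) (FM LG (\<alpha> (FO F a))) (\<beta> (FO G (FO F a)))) (gA (\<eta> a))"
    by (rule LA.Comp_assoc[OF \<eta> \<beta>_hom[OF GFa] LG_hom[OF \<alpha>]])
  also have "\<dots> = gA (\<eta> a)"
    using adj_locD(6)[OF Fa] LA.Ident_Comp[OF \<eta>] by (simp add: FO_loc_functor Fa)
  finally show ?thesis .
qed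

text \<open>The counit of \<open>loc Q \<stileturn> loc G\<close> is determined by the comparison at objects \<open>G x\<close>; this gives
  uniqueness of factorizations in the Kan extension property.\<close>

lemma counit_comparison:
  assumes x: "x \<in> Obj B"
  shows "Comp (loc B) (gB (\<kappa> x)) (comparison (FO G x)) = \<alpha> x"
proof -
  note Gx = functor_Obj[OF G x]
  note \<kappa> = counit_hom[OF x]
  note G\<kappa> = functor_hom[OF G \<kappa>]
  note \<alpha> = \<alpha>_hom[OF x] \<alpha>_hom[OF functor_Obj[OF F Gx]]
  note \<eta> = gA[OF unit_hom[OF Gx]]
  have "Comp (loc B) (gB (\<kappa> x)) (comparison (FO G x)) =
      Comp (loc B) (Comp (loc B) (gB (\<kappa> x)) (\<alpha> (FO F (FO G x)))) (FM LQ (gA (\<eta> (FO G x))))"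
    unfolding comparison_eq[OF Gx] by (rule LB.Comp_assoc[OF LQ_hom[OF \<eta>] \<alpha>(2) gB[OF \<kappa>]])
  also have "\<dots> = Comp (loc B) (Comp (loc B) (\<alpha> x) (FM LQ (gA (FM G (\<kappa> x)))))
      (FM LQ (gA (\<eta> (FO G x))))"
    by (simp only: \<alpha>_square[OF \<kappa>])
  also have "\<dots> = Comp (loc B) (\<alpha> x)
      (Comp (loc B) (FM LQ (gA (FM G (\<kappa> x)))) (FM LQ (gA (\<eta> (FO G x)))))"
    by (rule LB.Comp_assoc[OF LQ_hom[OF \<eta>] LQ_hom[OF gA[OF G\<kappa>]] \<alpha>(1), symmetric])
  also have "Comp (loc B) (FM LQ (gA (FM G (\<kappa> x)))) (FM LQ (gA (\<eta> (FO G x)))) =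
      FM LQ (gA (Comp A (FM G (\<kappa> x)) (\<eta> (FO G x))))"
    by (simp only: functor_hom_Comp[OF LQ \<eta> gA[OF G\<kappa>]]
        functor_hom_Comp[OF is_functor_gamma[OF A_cat] unit_hom[OF Gx] G\<kappa>])
  also have "\<dots> = Ident (loc B) (FO Q (FO G x))"
    using Gx by (simp add: triangle_G[OF x] functor_Ident[OF is_functor_gamma[OF A_cat]]
        functor_Ident[OF LQ] FO_gamma FO_loc_functor)
  also have "Comp (loc B) (\<alpha> x) \<dots> = \<alpha> x"
    by (rule LB.Comp_Ident[OF \<alpha>(1)])
  finally show ?thesis .
qed

text \<open>Let \<open>\<tau> : T \<gamma> \<rightarrow> H \<gamma> F\<close>. The transformation \<open>\<theta> = H \<gamma> \<kappa> \<circ> \<tau> G : T (loc G) \<rightarrow> H\<close> is natural on \<open>B\<close>,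
  hence on \<open>loc B\<close>, and its transpose along \<open>loc Q \<stileturn> loc G\<close> is
  \<open>\<sigma> a = \<theta> (Q a) \<circ> T (\<beta> a)\<close>. That \<open>\<sigma>\<close> factors \<open>\<tau>\<close> comes from the triangle
  identity \<open>\<kappa> F \<circ> F \<eta> = 1\<close>; that it is the only one comes from \<open>\<alpha> Q \<circ> loc Q \<beta> = 1\<close>. The
  functor \<open>H\<close> is carried through all of this without change, which is what makes the Kan
  extension absolute.\<close>

lemma right_kan_extension_comparison:
  fixes X :: "('x, 'y, 'z) cat_scheme"
  assumes X: "category X" and H: "is_functor (loc B) X H"
  shows "right_kan_extension A (loc A) X (loc_gamma A)
    (comp_functor A H (comp_functor A (loc_gamma B) F)) (comp_functor (loc A) H LQ)
    (\<lambda>a \<in> Obj A. FM H (comparison a))"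
  unfolding right_kan_extension_def
proof (intro conjI allI impI)
  interpret X: category X by (rule X)
  note gA_fun = is_functor_gamma[OF A_cat] and gB_fun = is_functor_gamma[OF B_cat]
  note HLQ = is_functor_comp[OF LA.category_axioms LQ H]
  show "is_functor A (loc A) (loc_gamma A)" by (rule gA_fun)
  show HgF: "is_functor A X (comp_functor A H (comp_functor A (loc_gamma B) F))"
    by (rule is_functor_comp[OF A_cat is_functor_comp[OF A_cat F gB_fun] H])
  show "is_functor (loc A) X (comp_functor (loc A) H LQ)" by (rule HLQ)
  note FOH = comp_functor_def FO_gamma FO_loc_functor functor_Obj[OF Q] functor_Obj[OF F]
    functor_Obj[OF G]
  show "nat_trans A X (comp_functor A (comp_functor (loc A) H LQ) (loc_gamma A))
      (comp_functor A H (comp_functor A (loc_gamma B) F)) (\<lambda>a \<in> Obj A. FM H (comparison a))"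
    unfolding nat_trans_def
  proof (intro conjI ballI)
    show "is_functor A X (comp_functor A (comp_functor (loc A) H LQ) (loc_gamma A))"
      by (rule is_functor_comp[OF A_cat gA_fun HLQ])
    show "is_functor A X (comp_functor A H (comp_functor A (loc_gamma B) F))" by (rule HgF)
    show "(\<lambda>a \<in> Obj A. FM H (comparison a)) \<in> extensional (Obj A)" by simp
    show "(\<lambda>a \<in> Obj A. FM H (comparison a)) a
        \<in> hom X (FO (comp_functor A (comp_functor (loc A) H LQ) (loc_gamma A)) a)
          (FO (comp_functor A H (comp_functor A (loc_gamma B) F)) a)" if "a \<in> Obj A" for a
      using functor_hom[OF H comparison_hom[OF that]] that by (simp add: FOH)
    fix f assume f: "f \<in> Arr A"
    then have f': "f \<in> hom A (Dom A f) (Cod A f)" by (simp add: hom_iff)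
    note a = A.hom_Obj[OF f']
    have "Comp X (FM H (gB (FM F f))) (FM H (comparison (Dom A f))) =
        Comp X (FM H (comparison (Cod A f))) (FM H (FM LQ (gA f)))"
      by (simp only: functor_hom_Comp[OF H comparison_hom[OF a(1)] gB[OF functor_hom[OF F f']]]
          functor_hom_Comp[OF H LQ_hom[OF gA[OF f']] comparison_hom[OF a(2)]]
          comparison_square[OF f'])
    then show "Comp X (FM (comp_functor A H (comp_functor A (loc_gamma B) F)) f)
          ((\<lambda>a \<in> Obj A. FM H (comparison a)) (Dom A f)) =
        Comp X ((\<lambda>a \<in> Obj A. FM H (comparison a)) (Cod A f))
          (FM (comp_functor A (comp_functor (loc A) H LQ) (loc_gamma A)) f)"
      using f a functor_Arr[OF gA_fun f] by (simp add: comp_functor_def)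
  qed
  fix T \<tau>
  assume T: "is_functor (loc A) X T"
    and nt: "nat_trans A X (comp_functor A T (loc_gamma A))
      (comp_functor A H (comp_functor A (loc_gamma B) F)) \<tau>"
  have \<tau>_hom: "\<tau> a \<in> hom X (FO T a) (FO H (FO F a))" if "a \<in> Obj A" for a
    using nat_trans_hom[OF nt that] that by (simp add: FOH)
  have \<tau>_square: "Comp X (FM H (gB (FM F f))) (\<tau> a) = Comp X (\<tau> a') (FM T (gA f))"
    if "f \<in> hom A a a'" for f a a'
    using nat_trans_square[OF nt, of f] that by (auto simp: hom_iff comp_functor_def)

  \<comment> \<open>The transformation that corresponds to \<open>\<tau>\<close> by transposition along \<open>F \<stileturn> G\<close>\<close>
  define \<theta> where "\<theta> = (\<lambda>x \<in> Obj B. Comp X (FM H (gB (\<kappa> x))) (\<tau> (FO G x)))"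
  have H\<kappa>: "FM H (gB (\<kappa> x)) \<in> hom X (FO H (FO F (FO G x))) (FO H x)" if "x \<in> Obj B" for x
    by (rule functor_hom[OF H gB[OF counit_hom[OF that]]])
  note \<tau>G = \<tau>_hom[OF functor_Obj[OF G]]
  have \<theta>_hom: "\<theta> x \<in> hom X (FO T (FO G x)) (FO H x)" if "x \<in> Obj B" for x
    using X.Comp_in[OF \<tau>G[OF that] H\<kappa>[OF that]] that by (simp add: \<theta>_def)
  have TLG: "is_functor (loc B) X (comp_functor (loc B) T LG)"
    by (rule is_functor_comp[OF LB.category_axioms LG T])
  have \<theta>_nat: "nat_trans (loc B) X (comp_functor (loc B) T LG) H \<theta>"
  proof (rule nat_trans_on_loc[OF B_cat X TLG H])
    show "\<theta> \<in> extensional (Obj B)" by (simp add: \<theta>_def)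
    show "\<theta> x \<in> hom X (FO (comp_functor (loc B) T LG) x) (FO H x)" if "x \<in> Obj B" for x
      using \<theta>_hom[OF that] that by (simp add: FOH)
    fix f assume f0: "f \<in> Arr B"
    define x y where "x = Dom B f" and "y = Cod B f"
    have f: "f \<in> hom B x y" using f0 by (simp add: hom_iff x_def y_def)
    note xy = B.hom_Obj[OF f]
    note Gf = functor_hom[OF G f]
    note FGf = functor_hom[OF F Gf]
    note \<kappa> = counit_hom[OF xy(1)] counit_hom[OF xy(2)]
    note Hf = functor_hom[OF H gB[OF f]] and HFGf = functor_hom[OF H gB[OF FGf]]
    have "Comp X (FM H (gB f)) (\<theta> x) = Comp X (Comp X (FM H (gB f)) (FM H (gB (\<kappa> x)))) (\<tau> (FO G x))"
      using X.Comp_assoc[OF \<tau>G[OF xy(1)] H\<kappa>[OF xy(1)] Hf] xy by (simp add: \<theta>_def)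
    also have "Comp X (FM H (gB f)) (FM H (gB (\<kappa> x))) = FM H (gB (Comp B f (\<kappa> x)))"
      by (simp only: functor_hom_Comp[OF H gB[OF \<kappa>(1)] gB[OF f]] functor_hom_Comp[OF gB_fun \<kappa>(1) f])
    also have "\<dots> = FM H (gB (Comp B (\<kappa> y) (FM F (FM G f))))"
      by (simp only: counit_square[OF f])
    also have "\<dots> = Comp X (FM H (gB (\<kappa> y))) (FM H (gB (FM F (FM G f))))"
      by (simp only: functor_hom_Comp[OF H gB[OF FGf] gB[OF \<kappa>(2)]]
          functor_hom_Comp[OF gB_fun FGf \<kappa>(2)])
    also have "Comp X \<dots> (\<tau> (FO G x)) =
        Comp X (FM H (gB (\<kappa> y))) (Comp X (FM H (gB (FM F (FM G f)))) (\<tau> (FO G x)))"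
      by (rule X.Comp_assoc[OF \<tau>G[OF xy(1)] HFGf H\<kappa>[OF xy(2)], symmetric])
    also have "\<dots> = Comp X (FM H (gB (\<kappa> y))) (Comp X (\<tau> (FO G y)) (FM T (gA (FM G f))))"
      by (simp only: \<tau>_square[OF Gf])
    also have "\<dots> = Comp X (\<theta> y) (FM T (gA (FM G f)))"
      using X.Comp_assoc[OF functor_hom[OF T gA[OF Gf]] \<tau>G[OF xy(2)] H\<kappa>[OF xy(2)]] xy
      by (simp add: \<theta>_def)
    finally show "Comp X (FM H (gB f)) (\<theta> (Dom B f)) =
        Comp X (\<theta> (Cod B f)) (FM (comp_functor (loc B) T LG) (gB f))"
      using gB[OF f] by (simp add: x_def y_def comp_functor_def LG_gB[OF f0] hom_iff)
  qed
  have \<theta>_square: "Comp X (FM H t) (\<theta> x) = Comp X (\<theta> y) (FM T (FM LG t))"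
    if "t \<in> hom (loc B) x y" for t x y
    using nat_trans_square[OF \<theta>_nat, of t] that by (auto simp: hom_iff comp_functor_def)

  \<comment> \<open>The transpose of \<open>\<theta>\<close> along \<open>loc Q \<stileturn> loc G\<close>\<close>
  define \<sigma> where "\<sigma> = (\<lambda>a \<in> Obj A. Comp X (\<theta> (FO Q a)) (FM T (\<beta> a)))"
  note T\<beta> = functor_hom[OF T \<beta>_hom]
  note \<theta>Q = \<theta>_hom[OF functor_Obj[OF Q]]
  have \<sigma>_hom: "\<sigma> a \<in> hom X (FO T a) (FO H (FO Q a))" if "a \<in> Obj A" for a
    using X.Comp_in[OF T\<beta>[OF that] \<theta>Q[OF that]] that by (simp add: \<sigma>_def)
  have \<sigma>_nat: "nat_trans (loc A) X T (comp_functor (loc A) H LQ) \<sigma>"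
    unfolding nat_trans_def Obj_loc
  proof (intro conjI ballI)
    show "is_functor (loc A) X T" "is_functor (loc A) X (comp_functor (loc A) H LQ)"
      by (rule T HLQ)+
    show "\<sigma> \<in> extensional (Obj A)" by (simp add: \<sigma>_def)
    show "\<sigma> a \<in> hom X (FO T a) (FO (comp_functor (loc A) H LQ) a)" if "a \<in> Obj A" for a
      using \<sigma>_hom[OF that] that by (simp add: FOH)
    fix t assume t0: "t \<in> Arr (loc A)"
    define a a' where "a = Dom (loc A) t" and "a' = Cod (loc A) t"
    have t: "t \<in> hom (loc A) a a'" using t0 by (simp add: hom_iff a_def a'_def)
    note aa = LA.hom_Obj[OF t, simplified]
    note LQt = LQ_hom[OF t]
    note LGLQt = LG_hom[OF LQt]
    have "Comp X (FM H (FM LQ t)) (\<sigma> a) =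
        Comp X (Comp X (FM H (FM LQ t)) (\<theta> (FO Q a))) (FM T (\<beta> a))"
      using X.Comp_assoc[OF T\<beta>[OF aa(1)] \<theta>Q[OF aa(1)] functor_hom[OF H LQt]] aa by (simp add: \<sigma>_def)
    also have "\<dots> = Comp X (Comp X (\<theta> (FO Q a')) (FM T (FM LG (FM LQ t)))) (FM T (\<beta> a))"
      by (simp only: \<theta>_square[OF LQt])
    also have "\<dots> = Comp X (\<theta> (FO Q a')) (Comp X (FM T (FM LG (FM LQ t))) (FM T (\<beta> a)))"
      by (rule X.Comp_assoc[OF T\<beta>[OF aa(1)] functor_hom[OF T LGLQt] \<theta>Q[OF aa(2)], symmetric])
    also have "Comp X (FM T (FM LG (FM LQ t))) (FM T (\<beta> a)) = Comp X (FM T (\<beta> a')) (FM T t)"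
      by (simp only: functor_hom_Comp[OF T \<beta>_hom[OF aa(1)] LGLQt]
          functor_hom_Comp[OF T t \<beta>_hom[OF aa(2)]] adj_locD(3)[OF t])
    also have "Comp X (\<theta> (FO Q a')) \<dots> = Comp X (\<sigma> a') (FM T t)"
      using X.Comp_assoc[OF functor_hom[OF T t] T\<beta>[OF aa(2)] \<theta>Q[OF aa(2)]] aa by (simp add: \<sigma>_def)
    finally show "Comp X (FM (comp_functor (loc A) H LQ) t) (\<sigma> (Dom (loc A) t)) =
        Comp X (\<sigma> (Cod (loc A) t)) (FM T t)"
      using t0 by (simp add: a_def a'_def comp_functor_def)
  qed
  have \<sigma>_factors: "Comp X (FM H (comparison a)) (\<sigma> a) = \<tau> a" if a: "a \<in> Obj A" for a
  proof -
    note \<epsilon> = comparison_hom[OF a] and \<eta> = unit_hom[OF a]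
    note Fa = functor_Obj[OF F a]
    note GFa = functor_Obj[OF G Fa]
    note F\<eta> = functor_hom[OF F \<eta>]
    have "Comp X (FM H (comparison a)) (\<sigma> a) =
        Comp X (Comp X (FM H (comparison a)) (\<theta> (FO Q a))) (FM T (\<beta> a))"
      using X.Comp_assoc[OF T\<beta>[OF a] \<theta>Q[OF a] functor_hom[OF H \<epsilon>]] a by (simp add: \<sigma>_def)
    also have "\<dots> = Comp X (Comp X (\<theta> (FO F a)) (FM T (FM LG (comparison a)))) (FM T (\<beta> a))"
      by (simp only: \<theta>_square[OF \<epsilon>])
    also have "\<dots> = Comp X (\<theta> (FO F a)) (Comp X (FM T (FM LG (comparison a))) (FM T (\<beta> a)))"
      by (rule X.Comp_assoc[OF T\<beta>[OF a] functor_hom[OF T LG_hom[OF \<epsilon>]] \<theta>_hom[OF Fa], symmetric])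
    also have "Comp X (FM T (FM LG (comparison a))) (FM T (\<beta> a)) = FM T (gA (\<eta> a))"
      by (simp only: functor_hom_Comp[OF T \<beta>_hom[OF a] LG_hom[OF \<epsilon>]] transpose_comparison[OF a])
    also have "Comp X (\<theta> (FO F a)) (FM T (gA (\<eta> a))) =
        Comp X (FM H (gB (\<kappa> (FO F a)))) (Comp X (\<tau> (FO G (FO F a))) (FM T (gA (\<eta> a))))"
      using X.Comp_assoc[OF functor_hom[OF T gA[OF \<eta>]] \<tau>G[OF Fa] H\<kappa>[OF Fa]] Fa
      by (simp add: \<theta>_def)
    also have "\<dots> = Comp X (FM H (gB (\<kappa> (FO F a)))) (Comp X (FM H (gB (FM F (\<eta> a)))) (\<tau> a))"
      by (simp only: \<tau>_square[OF \<eta>])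
    also have "\<dots> = Comp X (Comp X (FM H (gB (\<kappa> (FO F a)))) (FM H (gB (FM F (\<eta> a))))) (\<tau> a)"
      by (rule X.Comp_assoc[OF \<tau>_hom[OF a] functor_hom[OF H gB[OF F\<eta>]] H\<kappa>[OF Fa]])
    also have "Comp X (FM H (gB (\<kappa> (FO F a)))) (FM H (gB (FM F (\<eta> a)))) =
        FM H (gB (Comp B (\<kappa> (FO F a)) (FM F (\<eta> a))))"
      by (simp only: functor_hom_Comp[OF H gB[OF F\<eta>] gB[OF counit_hom[OF Fa]]]
          functor_hom_Comp[OF gB_fun F\<eta> counit_hom[OF Fa]])
    also have "\<dots> = Ident X (FO H (FO F a))"
      using Fa by (simp add: triangle_F[OF a] functor_Ident[OF gB_fun] functor_Ident[OF H] FO_gamma)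
    also have "Comp X \<dots> (\<tau> a) = \<tau> a"
      by (rule X.Ident_Comp[OF \<tau>_hom[OF a]])
    finally show ?thesis .
  qed
  have \<sigma>_unique: "\<rho> = \<sigma>"
    if \<rho>: "nat_trans (loc A) X T (comp_functor (loc A) H LQ) \<rho>"
      and fac: "\<And>a. a \<in> Obj A \<Longrightarrow> Comp X (FM H (comparison a)) (\<rho> a) = \<tau> a" for \<rho>
  proof
    fix a
    show "\<rho> a = \<sigma> a"
    proof (cases "a \<in> Obj A")
      case False
      then show ?thesis
        using nat_trans_ext[OF \<rho>] nat_trans_ext[OF \<sigma>_nat] by (simp add: extensional_def)
    next
      case a: True
      have \<rho>_hom: "\<rho> b \<in> hom X (FO T b) (FO H (FO Q b))" if "b \<in> Obj A" for b
        using nat_trans_hom[OF \<rho>, of b] that by (simp add: FOH)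
      note Qa = functor_Obj[OF Q a]
      note GQa = functor_Obj[OF G Qa]
      note \<alpha> = \<alpha>_hom[OF Qa] and \<beta> = \<beta>_hom[OF a]
      note \<epsilon> = comparison_hom[OF GQa]
      have sq: "Comp X (FM H (FM LQ (\<beta> a))) (\<rho> a) = Comp X (\<rho> (FO G (FO Q a))) (FM T (\<beta> a))"
        using nat_trans_square[OF \<rho>, of "\<beta> a"] \<beta> by (auto simp: hom_iff comp_functor_def)
      \<comment> \<open>Insert \<open>H\<close> of \<open>\<alpha> (Q a) \<circ> loc Q (\<beta> a) = 1\<close>, move \<open>\<rho>\<close> past \<open>\<beta> a\<close>, and express
        \<open>\<alpha> (Q a)\<close> by the comparison at \<open>G (Q a)\<close>, where \<open>\<rho>\<close> is known to factor \<open>\<tau>\<close>.\<close>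
      have "\<rho> a = Comp X (Ident X (FO H (FO Q a))) (\<rho> a)"
        by (rule X.Ident_Comp[OF \<rho>_hom[OF a], symmetric])
      also have "Ident X (FO H (FO Q a)) = FM H (Comp (loc B) (\<alpha> (FO Q a)) (FM LQ (\<beta> a)))"
        using adj_locD(5)[OF a] a Qa by (simp add: FO_loc_functor functor_Ident[OF H])
      also have "\<dots> = Comp X (FM H (\<alpha> (FO Q a))) (FM H (FM LQ (\<beta> a)))"
        by (rule functor_hom_Comp[OF H LQ_hom[OF \<beta>] \<alpha>, symmetric])
      also have "Comp X \<dots> (\<rho> a) = Comp X (FM H (\<alpha> (FO Q a))) (Comp X (FM H (FM LQ (\<beta> a))) (\<rho> a))"
        by (rule X.Comp_assoc[OF \<rho>_hom[OF a] functor_hom[OF H LQ_hom[OF \<beta>]] functor_hom[OF H \<alpha>],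
              symmetric])
      also have "\<dots> = Comp X (Comp X (FM H (\<alpha> (FO Q a))) (\<rho> (FO G (FO Q a)))) (FM T (\<beta> a))"
        unfolding sq
        by (rule X.Comp_assoc[OF T\<beta>[OF a] \<rho>_hom[OF GQa] functor_hom[OF H \<alpha>]])
      also have "Comp X (FM H (\<alpha> (FO Q a))) (\<rho> (FO G (FO Q a))) = \<theta> (FO Q a)"
      proof -
        note \<kappa> = counit_hom[OF Qa]
        have "FM H (\<alpha> (FO Q a)) =
            Comp X (FM H (gB (\<kappa> (FO Q a)))) (FM H (comparison (FO G (FO Q a))))"
          by (simp only: functor_hom_Comp[OF H \<epsilon> gB[OF \<kappa>]] counit_comparison[OF Qa])
        then show ?thesis
          using X.Comp_assoc[OF \<rho>_hom[OF GQa] functor_hom[OF H \<epsilon>] H\<kappa>[OF Qa]] fac[OF GQa] Qa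
          by (simp add: \<theta>_def)
      qed
      also have "Comp X (\<theta> (FO Q a)) (FM T (\<beta> a)) = \<sigma> a"
        using a by (simp add: \<sigma>_def)
      finally show ?thesis .
    qed
  qed
  show "\<exists>!\<sigma>. nat_trans (loc A) X T (comp_functor (loc A) H LQ) \<sigma> \<and>
      (\<forall>a \<in> Obj A. Comp X ((\<lambda>a \<in> Obj A. FM H (comparison a)) a) (\<sigma> (FO (loc_gamma A) a)) = \<tau> a)"
  proof (rule ex1I[of _ \<sigma>])
    show "nat_trans (loc A) X T (comp_functor (loc A) H LQ) \<sigma> \<and>
      (\<forall>a \<in> Obj A. Comp X ((\<lambda>a \<in> Obj A. FM H (comparison a)) a) (\<sigma> (FO (loc_gamma A) a)) = \<tau> a)"
      using \<sigma>_nat \<sigma>_factors by (simp add: FO_gamma)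
  qed (use \<sigma>_unique in \<open>simp add: FO_gamma\<close>)
qed

text \<open>The Kan extension property itself is the case in which \<open>H\<close> is the identity.\<close>

theorem absolute_left_derived_functor_comparison:
  "absolute_left_derived_functor TYPE('x) TYPE('y) A B F LQ comparison"
proof -
  have "comp_functor A (id_functor (loc B)) (comp_functor A (loc_gamma B) F) =
      comp_functor A (loc_gamma B) F"
    by (intro comp_id_functor[OF A_cat] is_functor_comp[OF A_cat F] is_functor_gamma[OF B_cat])
  moreover have "comp_functor (loc A) (id_functor (loc B)) LQ = LQ"
    by (rule comp_id_functor[OF LA.category_axioms LQ])
  moreover have "(\<lambda>a \<in> Obj A. FM (id_functor (loc B)) (comparison a)) = comparison"
  proof
    fix a
    show "(\<lambda>a \<in> Obj A. FM (id_functor (loc B)) (comparison a)) a = comparison a"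
      using comparison_hom[of a] by (auto simp: id_functor_def hom_iff comparison_def)
  qed
  ultimately have "right_kan_extension A (loc A) (loc B) (loc_gamma A)
      (comp_functor A (loc_gamma B) F) LQ comparison"
    using right_kan_extension_comparison[OF LB.category_axioms is_functor_id[OF LB.category_axioms]]
    by simp
  then show ?thesis
    unfolding absolute_left_derived_functor_def absolute_right_kan_extension_def
    using right_kan_extension_comparison by blast
qed

end

section \<open>The colimit functor is left adjoint to the constant diagram functor\<close>

lemma diagrams_simps:
  "X \<in> Obj (diagrams I C) \<longleftrightarrow> is_functor I C X"
  "(X, \<tau>, Y) \<in> Arr (diagrams I C) \<longleftrightarrow> nat_trans I C X Y \<tau>"
  "Dom (diagrams I C) (X, \<tau>, Y) = X"
  "Cod (diagrams I C) (X, \<tau>, Y) = Y"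
  "Ident (diagrams I C) X = (X, \<lambda>i \<in> Obj I. Ident C (FO X i), X)"
  "Comp (diagrams I C) (Y', \<sigma>, Z) (X, \<tau>, Y) = (X, \<lambda>i \<in> Obj I. Comp C (\<sigma> i) (\<tau> i), Z)"
  unfolding diagrams_def by (auto simp: functors_on_simps dest: nat_trans_functors)

lemma hom_diagrams:
  "t \<in> hom (diagrams I C) X Y \<longleftrightarrow> (\<exists>\<tau>. t = (X, \<tau>, Y) \<and> nat_trans I C X Y \<tau>)"
  by (cases t rule: prod_cases3) (auto simp: hom_iff diagrams_simps)

lemma category_diagrams: "category I \<Longrightarrow> category C \<Longrightarrow> category (diagrams I C)"
  unfolding diagrams_def by (rule category_functors_on) auto

lemma Weq_diagrams: "Weq (diagrams I C) \<subseteq> Arr (diagrams I C)"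
  unfolding diagrams_def by (rule Weq_functors_on)

lemma is_functor_const:
  assumes I: "category I" and C: "category C" and x: "x \<in> Obj C"
  shows "is_functor I C (const_functor I C x)"
proof -
  interpret I: category I by (rule I)
  interpret C: category C by (rule C)
  show ?thesis
    by (rule is_functorI) (simp_all add: const_functor_def hom_iff x I.Dom_in I.Cod_in)
qed

lemma nat_trans_const:
  assumes I: "category I" and C: "category C" and f: "f \<in> hom C x y"
  shows "nat_trans I C (const_functor I C x) (const_functor I C y) (\<lambda>i \<in> Obj I. f)"
proof -
  interpret I: category I by (rule I)
  interpret C: category C by (rule C)
  show ?thesis
    using f C.hom_Obj[OF f] is_functor_const[OF I C]
    by (simp add: nat_trans_def) (simp add: const_functor_def hom_iff I.Dom_in I.Cod_in)
qed

lemma is_functor_const_diagram: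
  assumes I: "category I" and C: "category C"
  shows "is_functor C (diagrams I C) (const_diagram I C)"
proof -
  interpret C: category C by (rule C)
  show ?thesis
  proof (rule is_functorI)
    show "FO (const_diagram I C) x \<in> Obj (diagrams I C)" if "x \<in> Obj C" for x
      using is_functor_const[OF I C that] that by (simp add: const_diagram_def diagrams_simps)
    show "FM (const_diagram I C) f
        \<in> hom (diagrams I C) (FO (const_diagram I C) (Dom C f)) (FO (const_diagram I C) (Cod C f))"
      if "f \<in> Arr C" for f
      using that nat_trans_const[OF I C, of f]
      by (simp add: const_diagram_def diagrams_simps C.Dom_in C.Cod_in hom_iff)
  qed (auto simp: const_diagram_def diagrams_simps const_functor_def cong: restrict_cong)
qed

lemma is_colimit_unique:
  assumes I: "category I" and C: "category C" and L: "is_colimit I C X L \<kappa>"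
    and u: "u \<in> hom C L M" and v: "v \<in> hom C L M"
    and eq: "\<And>i. i \<in> Obj I \<Longrightarrow> Comp C u (\<kappa> i) = Comp C v (\<kappa> i)"
  shows "u = v"
proof -
  have M: "M \<in> Obj C" using category.hom_Obj[OF C u] by simp
  have "nat_trans I C X (const_functor I C L) \<kappa>" using L by (simp add: is_colimit_def)
  from nat_trans_comp[OF I C this nat_trans_const[OF I C v]]
  have "nat_trans I C X (const_functor I C M) (\<lambda>i \<in> Obj I. Comp C v (\<kappa> i))"
    by (simp cong: restrict_cong)
  then have "\<exists>!w. w \<in> hom C L M \<and> (\<forall>i \<in> Obj I. Comp C w (\<kappa> i) = (\<lambda>i \<in> Obj I. Comp C v (\<kappa> i)) i)"
    using L M unfolding is_colimit_def by blast
  moreover have "\<forall>i \<in> Obj I. Comp C u (\<kappa> i) = (\<lambda>i \<in> Obj I. Comp C v (\<kappa> i)) i"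
    "\<forall>i \<in> Obj I. Comp C v (\<kappa> i) = (\<lambda>i \<in> Obj I. Comp C v (\<kappa> i)) i"
    by (simp_all add: eq)
  ultimately show ?thesis using u v by blast
qed

text \<open>The counit at \<open>x\<close> is the arrow \<open>colim (c x) \<rightarrow> x\<close> induced by the cocone of identities on the
  constant diagram. Naturality and the triangle identity at \<open>colim X\<close> are equalities between
  arrows out of a colimit, so they are checked on universal cocones; the triangle
  identity at \<open>c x\<close> is the defining property of the counit.\<close>

theorem colimit_adjunction:
  fixes C :: "('o, 'm, 's) relcat_scheme" and I :: "('i, 'j, 'r) cat_scheme"
  assumes I: "category I" and C: "category C" and col: "colimit_functor I C K \<eta>"
  obtains \<kappa> where "adjunction (diagrams I C) C K (const_diagram I C) \<eta> \<kappa>"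
proof -
  interpret C: category C by (rule C)
  interpret I: category I by (rule I)
  let ?A = "diagrams I C" and ?c = "const_diagram I C"
  interpret A: category ?A by (rule category_diagrams[OF I C])
  have K: "is_functor ?A C K"
    and \<eta>: "nat_trans ?A ?A (id_functor ?A) (comp_functor ?A ?c K) \<eta>"
    and univ: "\<And>X. X \<in> Obj ?A \<Longrightarrow> is_colimit I C X (FO K X) (nt_map (\<eta> X))"
    using col by (auto simp: colimit_functor_def)
  note c = is_functor_const_diagram[OF I C]
  have FO_c: "FO ?c x = const_functor I C x" if "x \<in> Obj C" for x
    using that by (simp add: const_diagram_def)
  have FM_c: "FM ?c f = (const_functor I C x, \<lambda>i \<in> Obj I. f, const_functor I C y)"
    if "f \<in> hom C x y" for f x y
    using that by (simp add: const_diagram_def hom_iff)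
  have \<eta>_hom: "\<eta> X \<in> hom ?A X (FO ?c (FO K X))" if "X \<in> Obj ?A" for X
    using nat_trans_hom[OF \<eta> that] that by (simp add: id_functor_def comp_functor_def)
  have \<eta>_triple: "\<eta> X = (X, nt_map (\<eta> X), FO ?c (FO K X))" if "X \<in> Obj ?A" for X
    using \<eta>_hom[OF that] by (auto simp: hom_diagrams nt_map_def)
  have cocone: "nt_map (\<eta> X) i \<in> hom C (FO X i) (FO K X)" if "X \<in> Obj ?A" "i \<in> Obj I" for X i
    using univ[OF that(1)] nat_trans_hom[of I C X "const_functor I C (FO K X)" "nt_map (\<eta> X)" i] that(2)
    by (simp add: is_colimit_def const_functor_def)
  have K_cocone: "Comp C (FM K f) (nt_map (\<eta> X) i) = Comp C (nt_map (\<eta> Y) i) (nt_map f i)"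
    if f: "f \<in> hom ?A X Y" and i: "i \<in> Obj I" for f X Y i
  proof -
    note XY = A.hom_Obj[OF f]
    obtain \<tau> where \<tau>: "f = (X, \<tau>, Y)" using f by (auto simp: hom_diagrams)
    have "Comp ?A (FM ?c (FM K f)) (\<eta> X) = Comp ?A (\<eta> Y) f"
      using nat_trans_square[OF \<eta>, of f] f by (auto simp: hom_iff id_functor_def comp_functor_def)
    then have "Comp ?A (const_functor I C (FO K X), \<lambda>i \<in> Obj I. FM K f, const_functor I C (FO K Y))
          (X, nt_map (\<eta> X), FO ?c (FO K X)) =
        Comp ?A (Y, nt_map (\<eta> Y), FO ?c (FO K Y)) (X, \<tau>, Y)"
      by (simp only: FM_c[OF functor_hom[OF K f], symmetric] \<eta>_triple[OF XY(1), symmetric]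
          \<eta>_triple[OF XY(2), symmetric] \<tau>[symmetric])
    then have "(\<lambda>i \<in> Obj I. Comp C (FM K f) (nt_map (\<eta> X) i)) =
        (\<lambda>i \<in> Obj I. Comp C (nt_map (\<eta> Y) i) (\<tau> i))"
      by (simp add: diagrams_simps cong: restrict_cong)
    from fun_cong[OF this, of i] show ?thesis using i by (simp add: \<tau> nt_map_def)
  qed
  have cx: "FO ?c x \<in> Obj ?A" if "x \<in> Obj C" for x by (rule functor_Obj[OF c that])
  have FO_cx: "FO (FO ?c x) i = x" if "x \<in> Obj C" "i \<in> Obj I" for x i
    using that by (simp add: FO_c const_functor_def)
  have nt_c: "nt_map (FM ?c f) i = f" if "f \<in> hom C x y" "i \<in> Obj I" for f x y i
    using that by (simp add: FM_c nt_map_def)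
  have unique: "u = v" if "X \<in> Obj ?A" "u \<in> hom C (FO K X) M" "v \<in> hom C (FO K X) M"
    "\<And>i. i \<in> Obj I \<Longrightarrow> Comp C u (nt_map (\<eta> X) i) = Comp C v (nt_map (\<eta> X) i)" for u v X M
    by (rule is_colimit_unique[OF I C univ[OF that(1)] that(2-4)])
  have "\<exists>u. u \<in> hom C (FO K (FO ?c x)) x \<and>
      (\<forall>i \<in> Obj I. Comp C u (nt_map (\<eta> (FO ?c x)) i) = Ident C x)" if x: "x \<in> Obj C" for x
  proof -
    have "nat_trans I C (FO ?c x) (const_functor I C x) (\<lambda>i \<in> Obj I. Ident C x)"
      using nat_trans_const[OF I C C.Ident_in[OF x]] by (simp add: FO_c[OF x])
    with univ[OF cx[OF x]] x have "\<exists>!u. u \<in> hom C (FO K (FO ?c x)) x \<and>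
        (\<forall>i \<in> Obj I. Comp C u (nt_map (\<eta> (FO ?c x)) i) = (\<lambda>i \<in> Obj I. Ident C x) i)"
      unfolding is_colimit_def by blast
    then show ?thesis by auto
  qed
  then obtain k where k: "\<And>x. x \<in> Obj C \<Longrightarrow> k x \<in> hom C (FO K (FO ?c x)) x"
    and k_cocone: "\<And>x i. x \<in> Obj C \<Longrightarrow> i \<in> Obj I \<Longrightarrow> Comp C (k x) (nt_map (\<eta> (FO ?c x)) i) = Ident C x"
    by metis
  define \<kappa> where "\<kappa> = (\<lambda>x \<in> Obj C. k x)"
  have k_square: "Comp C f (k x) = Comp C (k y) (FM K (FM ?c f))" if f: "f \<in> hom C x y" for f x y
  proof -
    note xy = C.hom_Obj[OF f]
    note cf = functor_hom[OF c f]
    note Kcf = functor_hom[OF K cf]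
    show ?thesis
    proof (rule unique[OF cx[OF xy(1)] C.Comp_in[OF k[OF xy(1)] f] C.Comp_in[OF Kcf k[OF xy(2)]]])
      fix i assume i: "i \<in> Obj I"
      note ex = cocone[OF cx[OF xy(1)] i] and ey = cocone[OF cx[OF xy(2)] i]
      have f': "f \<in> hom C (FO (FO ?c x) i) (FO (FO ?c y) i)" using f by (simp add: FO_cx xy i)
      have "Comp C (Comp C f (k x)) (nt_map (\<eta> (FO ?c x)) i) = f"
        using C.Comp_assoc[OF ex k[OF xy(1)] f] f by (simp add: k_cocone xy i C.Comp_Ident[OF f])
      moreover have "Comp C (Comp C (k y) (FM K (FM ?c f))) (nt_map (\<eta> (FO ?c x)) i) = f"
        using C.Comp_assoc[OF ex Kcf k[OF xy(2)]] C.Comp_assoc[OF f' ey k[OF xy(2)]]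
        by (simp add: K_cocone[OF cf i] nt_c[OF f i] k_cocone xy i C.Ident_Comp[OF f])
      ultimately show "Comp C (Comp C f (k x)) (nt_map (\<eta> (FO ?c x)) i) =
          Comp C (Comp C (k y) (FM K (FM ?c f))) (nt_map (\<eta> (FO ?c x)) i)" by simp
    qed
  qed
  have Kc: "is_functor C C (comp_functor C K ?c)" by (rule is_functor_comp[OF C c K])
  have \<kappa>_nat: "nat_trans C C (comp_functor C K ?c) (id_functor C) \<kappa>"
    unfolding nat_trans_def
  proof (intro conjI ballI)
    show "is_functor C C (comp_functor C K ?c)" by (rule Kc)
    show "is_functor C C (id_functor C)" by (rule is_functor_id[OF C])
    show "\<kappa> \<in> extensional (Obj C)" by (simp add: \<kappa>_def)
    show "\<kappa> x \<in> hom C (FO (comp_functor C K ?c) x) (FO (id_functor C) x)" if "x \<in> Obj C" for x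
      using k[OF that] that by (simp add: \<kappa>_def comp_functor_def id_functor_def)
    show "Comp C (FM (id_functor C) f) (\<kappa> (Dom C f)) =
        Comp C (\<kappa> (Cod C f)) (FM (comp_functor C K ?c) f)" if "f \<in> Arr C" for f
      using k_square[of f "Dom C f" "Cod C f"] that
      by (simp add: \<kappa>_def comp_functor_def id_functor_def hom_iff C.Dom_in C.Cod_in)
  qed
  have tri_K: "Comp C (\<kappa> (FO K X)) (FM K (\<eta> X)) = Ident C (FO K X)" if X: "X \<in> Obj ?A" for X
  proof -
    note KX = functor_Obj[OF K X]
    note K\<eta> = functor_hom[OF K \<eta>_hom[OF X]]
    have "Comp C (k (FO K X)) (FM K (\<eta> X)) = Ident C (FO K X)"
    proof (rule unique[OF X C.Comp_in[OF K\<eta> k[OF KX]] C.Ident_in[OF KX]])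
      fix i assume i: "i \<in> Obj I"
      note eX = cocone[OF X i] and ecX = cocone[OF cx[OF KX] i]
      have eX': "nt_map (\<eta> X) i \<in> hom C (FO X i) (FO (FO ?c (FO K X)) i)"
        using eX by (simp add: FO_cx KX i)
      show "Comp C (Comp C (k (FO K X)) (FM K (\<eta> X))) (nt_map (\<eta> X) i) =
          Comp C (Ident C (FO K X)) (nt_map (\<eta> X) i)"
        using C.Comp_assoc[OF eX K\<eta> k[OF KX]] C.Comp_assoc[OF eX' ecX k[OF KX]]
        by (simp add: K_cocone[OF \<eta>_hom[OF X] i] k_cocone KX i)
    qed
    then show ?thesis by (simp add: \<kappa>_def KX)
  qed
  have tri_c: "Comp ?A (FM ?c (\<kappa> x)) (\<eta> (FO ?c x)) = Ident ?A (FO ?c x)" if x: "x \<in> Obj C" for x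
  proof -
    have "Comp ?A (FM ?c (k x)) (\<eta> (FO ?c x)) = Ident ?A (FO ?c x)"
      unfolding FM_c[OF k[OF x]] by (subst \<eta>_triple[OF cx[OF x]])
        (simp add: diagrams_simps k_cocone x FO_cx FO_c[symmetric] cong: restrict_cong)
    then show ?thesis by (simp add: \<kappa>_def x)
  qed
  show thesis
    by (rule that[of \<kappa>]) (simp add: adjunction_def K c \<eta> \<kappa>_nat tri_K tri_c)
qed

section \<open>Realizable homotopy colimits\<close>

theorem proposition2p17:
  fixes C :: "('o, 'm) relcat"
    and I :: "('i, 'j) cat"
    and colim hocolim :: "(('i, 'j, 'o, 'm) func, ('i, 'j, 'o, 'm) ntarr, 'o, 'm) func"
  assumes "relative_category C"
    and "category I"
    and "colimit_functor I C colim \<eta>"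
    and "realizable_hocolim I C hocolim \<alpha> \<beta>"
  shows "absolute_left_derived_functor TYPE('x) TYPE('y) (diagrams I C) C colim
           (loc_functor (diagrams I C) C hocolim) (hocolim_comparison I C colim \<eta> hocolim \<alpha>)"
proof -
  have C: "category C" and W: "Weq C \<subseteq> Arr C"
    using assms(1) by (auto simp: relative_category_def)
  note D = category_diagrams[OF assms(2) C]
  note rel = assms(4)[unfolded realizable_hocolim_def]
  obtain \<kappa> where adj: "adjunction (diagrams I C) C colim (const_diagram I C) \<eta> \<kappa>"
    using colimit_adjunction[OF assms(2) C assms(3)] .
  interpret D: category "diagrams I C" by (rule D)
  interpret C: category C by (rule C)
  interpret localized_adjunction "diagrams I C" C colim hocolim "const_diagram I C" \<eta> \<kappa>
    "\<lambda>X \<in> Obj (diagrams I C). rel_component (diagrams I C) (diagrams I C) \<beta> X"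
    "\<lambda>x \<in> Obj C. rel_component C C \<alpha> x"
    using rel adj adjunction_loc[OF D C Weq_diagrams W rel]
    by unfold_locales (auto simp: relative_adjunction_def)
  have "comparison = hocolim_comparison I C colim \<eta> hocolim \<alpha>"
    unfolding comparison_def hocolim_comparison_def
    using functor_Obj[OF F] by (simp cong: restrict_cong)
  with absolute_left_derived_functor_comparison[where 'x = 'x and 'y = 'y] show ?thesis by simp
qed

end
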